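(* Let $p$ be a prime, let $G$ be a finite $p$-group of order $p^n$, and let $\chi$ be a non-linear irreducible complex character of $G$. Then $\chi(g)=0$ for at least $p^n-p^{n-1}+p^2-p$ elements $g\in G$. If equality holds (that is, if $\chi$ vanishes at exactly $p^n-p^{n-1}+p^2-p$ elements of $G$), then $G$ is a $p$-group of maximal class with an abelian maximal subgroup.
   Context: A character $\chi$ is linear if $\chi(1)=1$ and non-linear otherwise. A $p$-group of order $p^n$ ($n\ge 2$) has maximal class if its nilpotency class is $n-1$. A maximal subgroup of a $p$-group is a subgroup of index $p$. *)

theory Defs
  imports "HOL-Algebra.Generated_Groups" "HOL-Computational_Algebra.Primes"
    "Jordan_Normal_Form.VS_Connect"
begin

section \<open>Complex characters of a group\<close>

definition GL :: "nat \<Rightarrow> complex mat monoid" where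
  "GL d = units_of (ring_mat TYPE(complex) d ())"

definition representation :: "('a, 'b) monoid_scheme \<Rightarrow> nat \<Rightarrow> ('a \<Rightarrow> complex mat) \<Rightarrow> bool" where
  "representation G d \<rho> \<longleftrightarrow> group G \<and> \<rho> \<in> hom G (GL d)"

definition invariant_subspace ::
  "('a, 'b) monoid_scheme \<Rightarrow> nat \<Rightarrow> ('a \<Rightarrow> complex mat) \<Rightarrow> complex vec set \<Rightarrow> bool" where
  "invariant_subspace G d \<rho> W \<longleftrightarrow>
     VectorSpace.subspace class_ring W (module_vec TYPE(complex) d) \<and>
     (\<forall>g\<in>carrier G. \<forall>v\<in>W. \<rho> g *\<^sub>v v \<in> W)"

definition irreducible_representation ::
  "('a, 'b) monoid_scheme \<Rightarrow> nat \<Rightarrow> ('a \<Rightarrow> complex mat) \<Rightarrow> bool" where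
  "irreducible_representation G d \<rho> \<longleftrightarrow>
     representation G d \<rho> \<and> d > 0 \<and>
     (\<forall>W. invariant_subspace G d \<rho> W \<longrightarrow> W = {0\<^sub>v d} \<or> W = carrier_vec d)"

definition mat_trace :: "'a :: comm_monoid_add mat \<Rightarrow> 'a" where
  "mat_trace A = (\<Sum>i<dim_row A. A $$ (i, i))"

text \<open>A character is only constrained on the carrier; its values elsewhere are irrelevant.\<close>

definition irreducible_character :: "('a, 'b) monoid_scheme \<Rightarrow> ('a \<Rightarrow> complex) \<Rightarrow> bool" where
  "irreducible_character G \<chi> \<longleftrightarrow>
     (\<exists>d \<rho>. irreducible_representation G d \<rho> \<and> (\<forall>g\<in>carrier G. \<chi> g = mat_trace (\<rho> g)))"

definition linear_character :: "('a, 'b) monoid_scheme \<Rightarrow> ('a \<Rightarrow> complex) \<Rightarrow> bool" where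
  "linear_character G \<chi> \<longleftrightarrow> \<chi> \<one>\<^bsub>G\<^esub> = 1"


section \<open>Nilpotency class and maximal class\<close>

definition commutator_subgroup :: "('a, 'b) monoid_scheme \<Rightarrow> 'a set \<Rightarrow> 'a set \<Rightarrow> 'a set" where
  "commutator_subgroup G H K =
     generate G (\<Union>h\<in>H. \<Union>k\<in>K. {h \<otimes>\<^bsub>G\<^esub> k \<otimes>\<^bsub>G\<^esub> (inv\<^bsub>G\<^esub> h) \<otimes>\<^bsub>G\<^esub> (inv\<^bsub>G\<^esub> k)})"

text \<open>The indexing starts at 0, so that the term with index \<open>i\<close> is usually written
  \<open>\<gamma>\<^sub>i\<^sub>+\<^sub>1(G)\<close>, and the nilpotency class is the least index of a trivial term.\<close>

primrec lower_central_series :: "('a, 'b) monoid_scheme \<Rightarrow> nat \<Rightarrow> 'a set" where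
  "lower_central_series G 0 = carrier G"
| "lower_central_series G (Suc i) = commutator_subgroup G (lower_central_series G i) (carrier G)"

definition nilpotent_group :: "('a, 'b) monoid_scheme \<Rightarrow> bool" where
  "nilpotent_group G \<longleftrightarrow> group G \<and> (\<exists>c. lower_central_series G c = {\<one>\<^bsub>G\<^esub>})"

definition nilpotency_class :: "('a, 'b) monoid_scheme \<Rightarrow> nat" where
  "nilpotency_class G = (LEAST c. lower_central_series G c = {\<one>\<^bsub>G\<^esub>})"

definition p_group_of_maximal_class :: "nat \<Rightarrow> ('a, 'b) monoid_scheme \<Rightarrow> bool" where
  "p_group_of_maximal_class p G \<longleftrightarrow>
     prime p \<and> nilpotent_group G \<and>
     (\<exists>n\<ge>2. Coset.order G = p ^ n \<and> nilpotency_class G = n - 1)"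

definition p_maximal_subgroup :: "nat \<Rightarrow> 'a set \<Rightarrow> ('a, 'b) monoid_scheme \<Rightarrow> bool" where
  "p_maximal_subgroup p M G \<longleftrightarrow> subgroup M G \<and> card (rcosets\<^bsub>G\<^esub> M) = p"

end

theory Submission
  imports Defs "HOL-Algebra.Multiplicative_Group" "Jordan_Normal_Form.Spectral_Radius"
begin

text \<open>Let \<open>\<rho>\<close> afford \<open>\<chi>\<close>, let \<open>K\<close> be its kernel and let \<open>Z\<close> be the normal subgroup of the elements that
  act as scalars. By Schur's lemma \<open>x \<in> Z\<close> if and only if all commutators \<open>[x, g]\<close> lie in \<open>K\<close>, that
  is, \<open>Z/K\<close> is the center of \<open>G/K\<close>. Zeros come from the following observation: if \<open>[g, y] \<in> Z - K\<close> for
  some \<open>y\<close>, then \<open>\<rho> g\<close> is a scalar other than 1 times a conjugate of itself, so its trace is 0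
  (\<open>trace_eq_zero\<close>).

  Since \<open>\<chi>\<close> is not linear, \<open>Z \<noteq> G\<close>, and as \<open>G/Z\<close> is a non-trivial p-group there is \<open>x \<notin> Z\<close> with
  \<open>x\<^sup>p \<in> Z\<close> and \<open>[x, g] \<in> Z\<close> for all \<open>g\<close>. The scalar by which \<open>[x, g]\<close> acts is a non-trivial
  homomorphism of \<open>g\<close> into the p-th roots of unity; its kernel \<open>M = {g. [x, g] \<in> K}\<close> has index \<open>p\<close>.
  Now \<open>\<chi>\<close> vanishes outside \<open>M\<close>, which gives \<open>p\<^sup>n - p\<^sup>n\<^sup>-\<^sup>1\<close> zeros, and also on the elements
  \<open>x\<^sup>i z\<close> with \<open>0 < i < p\<close> and \<open>z \<in> Z\<close>. These lie in \<open>M\<close>, there are \<open>(p - 1) |Z|\<close> of them, and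
  \<open>|Z| \<ge> p\<close>.

  If equality holds, then \<open>|Z| = p\<close>, hence \<open>K = 1\<close> and \<open>Z\<close> is the center of \<open>G\<close>, and the only zeros in \<open>M\<close> are
  the \<open>x\<^sup>i z\<close>; these are central in \<open>M\<close>. If \<open>M\<close> were not abelian, then there would be \<open>b\<close> in \<open>M\<close>,
  not central in \<open>M\<close>, and \<open>m \<in> M\<close> with \<open>1 \<noteq> [b, m] \<in> Z\<close>
  (\<open>nonabelian_normal_subgroup_central_commutator\<close>); then \<open>\<chi> b = 0\<close>, a contradiction. So
  \<open>M\<close> is abelian of index \<open>p\<close>, and the center has order \<open>p\<close>. For \<open>g \<notin> M\<close> the map
  \<open>a \<mapsto> [a, g]\<close> is then an endomorphism of \<open>M\<close> with kernel \<open>Z\<close> that carries \<open>M\<close> onto the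
  second term of the lower central series and each later term onto its successor. So from \<open>M\<close> on the orders
  drop by the factor \<open>p\<close> only, and \<open>G\<close> has maximal class (\<open>maximal_class_if_abelian_maximal_subgroup\<close>).\<close>

section \<open>Commutators, kernels and the center\<close>

definition comm :: "('a, 'b) monoid_scheme \<Rightarrow> 'a \<Rightarrow> 'a \<Rightarrow> 'a" where
  "comm G x y = x \<otimes>\<^bsub>G\<^esub> y \<otimes>\<^bsub>G\<^esub> inv\<^bsub>G\<^esub> x \<otimes>\<^bsub>G\<^esub> inv\<^bsub>G\<^esub> y"

context group
begin

text \<open>These two cancellation rules, associativity and the rule for the inverse of a product together
  reduce any word in a group to its freely reduced form, so that the simplifier decides commutator
  identities.\<close>
lemma mult_inv_cancel_left:
  assumes "x \<in> carrier G" "y \<in> carrier G"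
  shows "x \<otimes> (inv x \<otimes> y) = y" "inv x \<otimes> (x \<otimes> y) = y"
  using assms by (simp_all add: m_assoc[symmetric])

lemmas word_simps = comm_def m_assoc inv_mult_group mult_inv_cancel_left

lemma comm_closed [simp, intro]:
  "x \<in> carrier G \<Longrightarrow> y \<in> carrier G \<Longrightarrow> comm G x y \<in> carrier G"
  by (simp add: comm_def)

lemma comm_eq_one_iff:
  assumes "x \<in> carrier G" "y \<in> carrier G"
  shows "comm G x y = \<one> \<longleftrightarrow> x \<otimes> y = y \<otimes> x"
proof -
  have "comm G x y = (x \<otimes> y) \<otimes> inv (y \<otimes> x)" using assms by (simp add: word_simps)
  then show ?thesis using assms by (simp add: inv_solve_right')
qed

lemma comm_self [simp]: "x \<in> carrier G \<Longrightarrow> comm G x x = \<one>"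
  by (simp add: comm_eq_one_iff)

lemma inv_comm:
  "x \<in> carrier G \<Longrightarrow> y \<in> carrier G \<Longrightarrow> inv (comm G x y) = comm G y x"
  by (simp add: word_simps)

lemma comm_mult_right:
  assumes "x \<in> carrier G" "y \<in> carrier G" "z \<in> carrier G"
  shows "comm G x (y \<otimes> z) = comm G x y \<otimes> (y \<otimes> comm G x z \<otimes> inv y)"
  using assms by (simp add: word_simps)

lemma comm_mult_left:
  assumes "x \<in> carrier G" "y \<in> carrier G" "z \<in> carrier G"
  shows "comm G (x \<otimes> y) z = (x \<otimes> comm G y z \<otimes> inv x) \<otimes> comm G x z"
  using assms by (simp add: word_simps)

lemma conj_eq_comm_mult:
  assumes "x \<in> carrier G" "y \<in> carrier G"
  shows "x \<otimes> y \<otimes> inv x = y \<otimes> comm G (inv y) x"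
  using assms by (simp add: word_simps)

lemma conj_comm:
  assumes "x \<in> carrier G" "y \<in> carrier G" "z \<in> carrier G"
  shows "z \<otimes> comm G x y \<otimes> inv z = comm G (z \<otimes> x \<otimes> inv z) (z \<otimes> y \<otimes> inv z)"
  using assms by (simp add: word_simps)

lemma normal_conj_closed:
  "N \<lhd> G \<Longrightarrow> a \<in> N \<Longrightarrow> x \<in> carrier G \<Longrightarrow> x \<otimes> a \<otimes> inv x \<in> N"
  by (simp add: normal_inv_iff)

lemma comm_in_normal:
  assumes "N \<lhd> G" "a \<in> N" "g \<in> carrier G"
  shows "comm G a g \<in> N" "comm G g a \<in> N"
proof -
  interpret normal N G by fact
  have a: "a \<in> carrier G" using assms by auto
  have "comm G a g = a \<otimes> (g \<otimes> inv a \<otimes> inv g)" using a assms by (simp add: word_simps)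
  then show 1: "comm G a g \<in> N" using assms normal_conj_closed[OF assms(1)] by simp
  show "comm G g a \<in> N" using inv_comm[OF a assms(3)] 1 by (metis m_inv_closed)
qed

text \<open>Inverses come for free, because they are positive powers in a finite group.\<close>
lemma finite_closed_subset_subgroup:
  assumes "finite (carrier G)" "H \<subseteq> carrier G" "H \<noteq> {}"
    "\<And>x y. x \<in> H \<Longrightarrow> y \<in> H \<Longrightarrow> x \<otimes> y \<in> H"
  shows "subgroup H G"
proof -
  have pow: "x [^] Suc k \<in> H" if x: "x \<in> H" for x and k :: nat
  proof (induction k)
    case 0
    have "x [^] Suc 0 = x" using x assms(2) by auto
    then show ?case using x by simp
  next
    case (Suc k)
    then show ?case using assms(4)[OF Suc x] by (subst nat_pow_Suc)
  qed
  show ?thesis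
  proof (rule subgroupI)
    fix x assume x: "x \<in> H"
    then have xG: "x \<in> carrier G" using assms by auto
    have "Coset.order G > 0" using assms(1) by (simp only: order_gt_0_iff_finite)
    then obtain m where m: "Coset.order G = Suc m" by (cases "Coset.order G") auto
    have one: "x [^] Suc m = \<one>" using pow_order_eq_1[OF xG] m by simp
    (* the exponent 2 * |G| - 1 is positive, so this power of x is a product of elements of H *)
    have "x [^] Suc (m + m) \<otimes> x = x [^] Suc m \<otimes> x [^] Suc m"
    proof -
      have "Suc m + Suc m = Suc (Suc (m + m))" by simp
      then show ?thesis using nat_pow_mult[OF xG, of "Suc m" "Suc m"] by (metis nat_pow_Suc)
    qed
    also have "\<dots> = \<one>" by (simp only: one l_one[OF one_closed])
    finally have "inv x = x [^] Suc (m + m)"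
      using xG by (intro inv_equality) auto
    then show "inv x \<in> H" using pow[OF x] by simp
  qed (use assms in auto)
qed

text \<open>This is the formula for the order of the image of a homomorphism, stated for a function with values in
  any type. So it applies to a homomorphism into the complex numbers, to \<open>a \<mapsto> [a, g]\<close> and to the
  orbit map \<open>g \<mapsto> g x g\<^sup>-\<^sup>1\<close>: only the fibres have to be cosets of \<open>K\<close>.\<close>
lemma card_eq_card_image_mult_card_kernel:
  assumes fin: "finite (carrier G)" and N: "subgroup N G" and K: "K \<subseteq> N"
    and f: "\<And>a b. a \<in> N \<Longrightarrow> b \<in> N \<Longrightarrow> f a = f b \<longleftrightarrow> inv a \<otimes> b \<in> K"
  shows "card N = card (f ` N) * card K"
proof -
  interpret N: subgroup N G by fact
  have finN: "finite N" using fin N.subset finite_subset by blast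
  have fibre: "card {b \<in> N. f b = y} = card K" if "y \<in> f ` N" for y
  proof -
    obtain a where a: "a \<in> N" "y = f a" using \<open>y \<in> f ` N\<close> by auto
    have "bij_betw (\<lambda>k. a \<otimes> k) K {b \<in> N. f b = y}"
    proof (rule bij_betw_byWitness[where f' = "\<lambda>b. inv a \<otimes> b"])
      show "\<forall>k\<in>K. inv a \<otimes> (a \<otimes> k) = k"
        using a K by (auto simp: mult_inv_cancel_left)
      show "\<forall>b\<in>{b \<in> N. f b = y}. a \<otimes> (inv a \<otimes> b) = b"
        using a by (auto simp: mult_inv_cancel_left)
      show "(\<otimes>) a ` K \<subseteq> {b \<in> N. f b = y}"
      proof (rule image_subsetI)
        fix k assume k: "k \<in> K"
        then have kN: "k \<in> N" using K by auto
        have "inv a \<otimes> (a \<otimes> k) = k" using a kN by (auto simp: mult_inv_cancel_left)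
        then show "a \<otimes> k \<in> {b \<in> N. f b = y}"
          using f[of a "a \<otimes> k"] a k kN by auto
      qed
      show "(\<lambda>b. inv a \<otimes> b) ` {b \<in> N. f b = y} \<subseteq> K"
      proof (rule image_subsetI)
        fix b assume "b \<in> {b \<in> N. f b = y}"
        then have b: "b \<in> N" "f b = y" by auto
        then have "f a = f b" using a by simp
        then show "inv a \<otimes> b \<in> K" using f[OF a(1) b(1)] by blast
      qed
    qed
    then show ?thesis by (simp add: bij_betw_same_card)
  qed
  have "card N = card (\<Union>y\<in>f ` N. {b \<in> N. f b = y})" by (rule arg_cong[where f = card]) auto
  also have "\<dots> = (\<Sum>y\<in>f ` N. card {b \<in> N. f b = y})"
    using finN by (intro card_UN_disjoint) auto
  also have "\<dots> = card (f ` N) * card K" using fibre by simp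
  finally show ?thesis .
qed

end

definition center :: "('a, 'b) monoid_scheme \<Rightarrow> 'a set" where
  "center G = {z \<in> carrier G. \<forall>g\<in>carrier G. z \<otimes>\<^bsub>G\<^esub> g = g \<otimes>\<^bsub>G\<^esub> z}"

context group
begin

lemma mult_commutes:
  assumes "x \<in> carrier G" "y \<in> carrier G" "z \<in> carrier G" "x \<otimes> z = z \<otimes> x" "y \<otimes> z = z \<otimes> y"
  shows "(x \<otimes> y) \<otimes> z = z \<otimes> (x \<otimes> y)"
proof -
  have "(x \<otimes> y) \<otimes> z = x \<otimes> (z \<otimes> y)" using assms(1-3) by (simp add: m_assoc assms(5))
  also have "\<dots> = (x \<otimes> z) \<otimes> y" using assms(1-3) by (simp add: m_assoc)
  also have "\<dots> = z \<otimes> (x \<otimes> y)" using assms(1-3) by (simp add: m_assoc assms(4))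
  finally show ?thesis .
qed

lemma inv_commutes:
  assumes "x \<in> carrier G" "z \<in> carrier G" "x \<otimes> z = z \<otimes> x"
  shows "inv x \<otimes> z = z \<otimes> inv x"
proof -
  have "inv x \<otimes> z = inv x \<otimes> (z \<otimes> x) \<otimes> inv x" using assms(1,2) by (simp add: m_assoc)
  also have "z \<otimes> x = x \<otimes> z" by (rule assms(3)[symmetric])
  also have "inv x \<otimes> (x \<otimes> z) \<otimes> inv x = z \<otimes> inv x"
    using assms(1,2) by (simp add: mult_inv_cancel_left)
  finally show ?thesis .
qed

lemma center_subgroup: "subgroup (center G) G"
proof (rule subgroupI)
  have "\<one> \<in> center G" by (simp add: center_def)
  then show "center G \<noteq> {}" by blast
next
  show "center G \<subseteq> carrier G" by (auto simp: center_def)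
  fix x assume x: "x \<in> center G"
  then show "inv x \<in> center G" unfolding center_def by (blast intro: inv_commutes inv_closed)
  fix y assume y: "y \<in> center G"
  with x show "x \<otimes> y \<in> center G" unfolding center_def by (blast intro: mult_commutes m_closed)
qed

end

section \<open>Normal subgroups of p-groups\<close>

locale finite_p_group = group +
  fixes p n :: nat
  assumes prime_p: "prime p" and order_eq: "Coset.order G = p ^ n"
begin

lemma finite_carrier [simp]: "finite (carrier G)"
proof -
  have "Coset.order G > 0" using prime_gt_0_nat[OF prime_p] by (simp add: order_eq)
  then show ?thesis by (simp only: order_gt_0_iff_finite)
qed

lemma finite_subgroup: "subgroup H G \<Longrightarrow> finite H"
  by (rule finite_subset[OF subgroup.subset finite_carrier])

lemma card_subgroup_dvd: "subgroup H G \<Longrightarrow> card H dvd p ^ n"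
  using lagrange_finite[OF finite_carrier, of H] order_eq by (metis dvd_triv_right)

lemma dvd_prime_power:
  assumes "k dvd p ^ m" obtains i where "i \<le> m" "k = p ^ i"
  using assms divides_primepow_nat[OF prime_p] by auto

lemma card_subgroup_power:
  assumes "subgroup H G"
  obtains i where "i \<le> n" "card H = p ^ i"
  using dvd_prime_power[OF card_subgroup_dvd[OF assms]] by blast

lemma prime_dvd_card_subgroup:
  assumes "subgroup H G" "H \<noteq> {\<one>}"
  shows "p dvd card H"
proof -
  obtain i where i: "card H = p ^ i" using card_subgroup_power[OF assms(1)] by blast
  have "card H \<noteq> 1"
  proof
    assume "card H = 1"
    then obtain a where "H = {a}" by (auto simp: card_1_singleton_iff)
    then show False using assms subgroup.one_closed[OF assms(1)] by simp
  qed
  then show ?thesis using i by (cases i) auto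
qed

lemma subgroup_above_maximal:
  assumes M: "card M * p = p ^ n" and H: "subgroup H G" "M \<subseteq> H" "M \<noteq> H"
  shows "H = carrier G"
proof -
  obtain i where i: "i \<le> n" "card H = p ^ i" using card_subgroup_power[OF H(1)] by blast
  have "card M < card H" using H by (intro psubset_card_mono finite_subgroup) auto
  then have "card M * p < card H * p"
    using prime_gt_0_nat[OF prime_p] by simp
  then have "p ^ n < p ^ Suc i"
    unfolding M i(2) power_Suc2 .
  then have "n < Suc i"
    by (rule power_less_imp_less_exp[OF prime_gt_1_nat[OF prime_p]])
  then have "i = n" using i(1) by simp
  then have "card H = card (carrier G)" using i order_eq by (simp add: Coset.order_def)
  then show ?thesis
    using card_subset_eq[OF finite_carrier subgroup.subset[OF H(1)]] by simp
qed

text \<open>The conjugacy classes in \<open>N\<close> have p-power size by the orbit-stabilizer formula. If no element of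
  \<open>N - {\<one>}\<close> were central, then all classes there would have size divisible by \<open>p\<close>, and so
  \<open>p\<close> would divide both \<open>|N| - 1\<close> and \<open>|N|\<close>. A suitable power of a non-trivial central element
  has order \<open>p\<close>.\<close>
lemma normal_subgroup_meets_center:
  assumes N: "N \<lhd> G" and nontriv: "N \<noteq> {\<one>}"
  shows "\<exists>z\<in>N. z \<noteq> \<one> \<and> z [^] p = \<one> \<and> (\<forall>g\<in>carrier G. z \<otimes> g = g \<otimes> z)"
proof -
  interpret N: normal N G by fact
  have sub: "subgroup N G" by (rule N.subgroup_axioms)
  have finN: "finite N" using finite_subgroup sub by blast
  have ex: "\<exists>z\<in>N - {\<one>}. \<forall>g\<in>carrier G. z \<otimes> g = g \<otimes> z"
  proof (rule ccontr)
    assume no: "\<not> ?thesis"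
    define r where "r = {(x, y). x \<in> N - {\<one>} \<and> y \<in> N - {\<one>} \<and>
                        (\<exists>g\<in>carrier G. y = g \<otimes> x \<otimes> inv g)}"
    have eq: "equiv (N - {\<one>}) r"
    proof (rule equivI)
      show "r \<subseteq> (N - {\<one>}) \<times> (N - {\<one>})" by (auto simp: r_def)
      show "refl_on (N - {\<one>}) r"
        by (auto simp: refl_on_def r_def intro!: bexI[of _ \<one>])
      show "sym r"
      proof (rule symI)
        fix x y assume "(x, y) \<in> r"
        then obtain g where g: "g \<in> carrier G" "y = g \<otimes> x \<otimes> inv g"
            "x \<in> N - {\<one>}" "y \<in> N - {\<one>}" by (auto simp: r_def)
        then have "x = inv g \<otimes> y \<otimes> inv (inv g)"
          by (auto simp: m_assoc mult_inv_cancel_left)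
        then show "(y, x) \<in> r" using g unfolding r_def by blast
      qed
      show "trans r"
      proof (rule transI)
        fix x y z assume "(x, y) \<in> r" "(y, z) \<in> r"
        then obtain g h where gh: "g \<in> carrier G" "y = g \<otimes> x \<otimes> inv g" "h \<in> carrier G"
            "z = h \<otimes> y \<otimes> inv h" and xz: "x \<in> N - {\<one>}" "z \<in> N - {\<one>}" by (auto simp: r_def)
        then have "z = (h \<otimes> g) \<otimes> x \<otimes> inv (h \<otimes> g)"
          by (auto simp: m_assoc inv_mult_group)
        then show "(x, z) \<in> r" using xz gh(1,3) unfolding r_def by blast
      qed
    qed
    have "p dvd card (N - {\<one>})"
    proof (rule equiv_imp_dvd_card[OF _ eq])
      show "finite (N - {\<one>})" using finN by simp
      fix X assume "X \<in> (N - {\<one>}) // r"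
      then obtain x where x: "x \<in> N - {\<one>}" "X = r `` {x}" by (auto elim: quotientE)
      have xG: "x \<in> carrier G" using x by auto
      have "g \<otimes> x \<otimes> inv g \<noteq> \<one>" if "g \<in> carrier G" for g
      proof
        assume "g \<otimes> x \<otimes> inv g = \<one>"
        then have "g \<otimes> x = g" using that xG by (simp add: inv_solve_right')
        then show False using that xG x by simp
      qed
      then have X: "X = (\<lambda>g. g \<otimes> x \<otimes> inv g) ` carrier G"
        using x normal_conj_closed[OF N] by (auto simp: r_def)
      define C where "C = {g \<in> carrier G. g \<otimes> x = x \<otimes> g}"
      have *: "card (carrier G) = card X * card C"
        unfolding X
      proof (rule card_eq_card_image_mult_card_kernel[OF finite_carrier subgroup_self])
        show "C \<subseteq> carrier G" by (auto simp: C_def)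
        fix a b assume ab: "a \<in> carrier G" "b \<in> carrier G"
        have "a \<otimes> x \<otimes> inv a = b \<otimes> x \<otimes> inv b \<longleftrightarrow> a \<otimes> x \<otimes> inv a \<otimes> b = b \<otimes> x"
          using ab xG by (simp add: inv_solve_right eq_commute)
        also have "\<dots> \<longleftrightarrow> x \<otimes> (inv a \<otimes> b) = inv a \<otimes> (b \<otimes> x)"
          using ab xG by (auto simp: inv_solve_left m_assoc)
        finally show "a \<otimes> x \<otimes> inv a = b \<otimes> x \<otimes> inv b \<longleftrightarrow> inv a \<otimes> b \<in> C"
          using ab xG by (auto simp: C_def m_assoc)
      qed
      have "C \<noteq> carrier G"
      proof
        assume C: "C = carrier G"
        have "x \<otimes> g = g \<otimes> x" if "g \<in> carrier G" for g
          using that[folded C] by (simp add: C_def)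
        then show False using no x by blast
      qed
      then have "card C \<noteq> card (carrier G)"
        using card_subset_eq[OF finite_carrier, of C] by (auto simp: C_def)
      then have "card X \<noteq> 1" using * by auto
      moreover have "p ^ n = card X * card C" using * order_eq by (simp add: Coset.order_def)
      then have "card X dvd p ^ n" by (simp only: dvd_triv_left)
      then obtain i where "card X = p ^ i" by (rule dvd_prime_power)
      ultimately show "p dvd card X" by (cases i) auto
    qed
    moreover have "p dvd card N" using prime_dvd_card_subgroup[OF sub nontriv] .
    moreover have "card N = Suc (card (N - {\<one>}))"
      by (rule card.remove[OF finN N.one_closed])
    ultimately have "p dvd 1" by (metis dvd_add_right_iff plus_1_eq_Suc add.commute)
    then show False using prime_p by simp
  qed
  then obtain z where z: "z \<in> N" "z \<noteq> \<one>" "\<forall>g\<in>carrier G. z \<otimes> g = g \<otimes> z" by auto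
  have zG: "z \<in> carrier G" using z by auto
  have ex: "\<exists>j. z [^] (p ^ j) = \<one>" using pow_order_eq_1[OF zG] order_eq by auto
  define j where "j = (LEAST j. z [^] (p ^ j) = \<one>)"
  have j: "z [^] (p ^ j) = \<one>" unfolding j_def by (rule LeastI_ex[OF ex])
  have "j \<noteq> 0"
  proof
    assume "j = 0"
    then have "z [^] (1::nat) = \<one>" using j by simp
    then show False using z zG by simp
  qed
  then obtain i where i: "j = Suc i" by (cases j) auto
  have ni: "z [^] (p ^ i) \<noteq> \<one>"
    using not_less_Least[of i "\<lambda>j. z [^] (p ^ j) = \<one>"] i j_def by auto
  have powN: "z [^] (k::nat) \<in> N" for k using z by (induction k) auto
  have powc: "z [^] k \<otimes> g = g \<otimes> z [^] k" if "g \<in> carrier G" for g and k :: nat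
    using group_commutes_pow[of z g k] that z zG by simp
  have "(z [^] (p ^ i)) [^] p = \<one>"
    using j i zG by (simp add: nat_pow_pow mult.commute)
  then show ?thesis using ni powN powc by blast
qed

text \<open>The previous lemma in the quotient by \<open>A\<close>, where \<open>B\<close> becomes a non-trivial normal subgroup.\<close>
lemma exists_central_modulo:
  assumes A: "A \<lhd> G" and B: "B \<lhd> G" and AB: "A \<subset> B"
  shows "\<exists>x\<in>B - A. x [^] p \<in> A \<and> (\<forall>g\<in>carrier G. comm G x g \<in> A)"
proof -
  interpret A: normal A G by fact
  interpret B: normal B G by fact
  interpret Q: group "G Mod A" by (rule A.factorgroup_is_group)
  define \<pi> where "\<pi> x = A #> x" for x
  have hom: "\<pi> \<in> hom G (G Mod A)" unfolding \<pi>_def by (rule A.r_coset_hom_Mod)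
  interpret h: group_hom G "G Mod A" \<pi>
    by (unfold_locales) (rule hom)
  have ker: "\<pi> x = \<one>\<^bsub>G Mod A\<^esub> \<longleftrightarrow> x \<in> A" if "x \<in> carrier G" for x
    using that unfolding \<pi>_def FactGroup_def
    using coset_join1[of A x] coset_join2[OF _ A.subgroup_axioms, of x] A.subgroup_axioms
    by auto
  have surj: "carrier (G Mod A) = \<pi> ` carrier G"
    by (auto simp: FactGroup_def RCOSETS_def \<pi>_def)
  have "Coset.order (G Mod A) * card A = p ^ n"
    using lagrange_finite[OF finite_carrier A.subgroup_axioms] order_eq
    by (simp add: FactGroup_def Coset.order_def)
  then obtain m where m: "Coset.order (G Mod A) = p ^ m"
    using dvd_prime_power[of "Coset.order (G Mod A)" n] by (metis dvd_triv_left)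
  interpret Q: finite_p_group "G Mod A" p m
    by unfold_locales (use prime_p m in auto)
  have Bsub: "subgroup (\<pi> ` B) (G Mod A)"
    by (rule h.subgroup_img_is_subgroup[OF B.subgroup_axioms])
  have "\<pi> ` B \<lhd> G Mod A"
    unfolding Q.normal_inv_iff
  proof (intro conjI ballI Bsub)
    fix q b assume "q \<in> carrier (G Mod A)" "b \<in> \<pi> ` B"
    then obtain g c where gc: "g \<in> carrier G" "q = \<pi> g" "c \<in> B" "b = \<pi> c"
      using surj by auto
    then have "q \<otimes>\<^bsub>G Mod A\<^esub> b \<otimes>\<^bsub>G Mod A\<^esub> inv\<^bsub>G Mod A\<^esub> q = \<pi> (g \<otimes> c \<otimes> inv g)"
      using B.subset by auto
    then show "q \<otimes>\<^bsub>G Mod A\<^esub> b \<otimes>\<^bsub>G Mod A\<^esub> inv\<^bsub>G Mod A\<^esub> q \<in> \<pi> ` B"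
      by (simp only:) (intro imageI normal_conj_closed[OF B] gc)
  qed
  moreover have "\<pi> ` B \<noteq> {\<one>\<^bsub>G Mod A\<^esub>}"
  proof -
    obtain b where b: "b \<in> B" "b \<notin> A" using AB by auto
    then have "\<pi> b \<noteq> \<one>\<^bsub>G Mod A\<^esub>" using ker B.subset by auto
    then show ?thesis using b by auto
  qed
  ultimately obtain x where x: "x \<in> B" "\<pi> x \<noteq> \<one>\<^bsub>G Mod A\<^esub>" "\<pi> x [^]\<^bsub>G Mod A\<^esub> p = \<one>\<^bsub>G Mod A\<^esub>"
      "\<forall>q\<in>carrier (G Mod A). \<pi> x \<otimes>\<^bsub>G Mod A\<^esub> q = q \<otimes>\<^bsub>G Mod A\<^esub> \<pi> x"
    using Q.normal_subgroup_meets_center[of "\<pi> ` B"] by auto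
  have xG: "x \<in> carrier G" using x B.subset by auto
  have "x [^] p \<in> A" using x xG ker[of "x [^] p"] by (simp add: h.hom_nat_pow)
  moreover have "comm G x g \<in> A" if g: "g \<in> carrier G" for g
  proof -
    have "\<pi> (comm G x g) = comm (G Mod A) (\<pi> x) (\<pi> g)"
      using xG g by (simp add: comm_def)
    also have "\<dots> = \<one>\<^bsub>G Mod A\<^esub>"
      using x(4) xG g by (subst Q.comm_eq_one_iff) auto
    finally show ?thesis using ker xG g by auto
  qed
  ultimately show ?thesis using x xG ker by blast
qed

text \<open>Let \<open>C\<close> be the center of \<open>M\<close>, and take \<open>b \<in> M - C\<close> central modulo \<open>C\<close>. Then
  \<open>m \<mapsto> [b, m]\<close> is a homomorphism from \<open>M\<close> to \<open>C\<close>. Its image is non-trivial and normal in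
  \<open>G\<close>, since conjugation changes \<open>b\<close> by a factor in \<open>C\<close> only; so it meets the center of \<open>G\<close>.\<close>
lemma nonabelian_normal_subgroup_central_commutator:
  assumes M: "M \<lhd> G" and nonab: "\<not> (\<forall>a\<in>M. \<forall>b\<in>M. a \<otimes> b = b \<otimes> a)"
  obtains b m where "b \<in> M" "m \<in> M" "\<exists>a\<in>M. a \<otimes> b \<noteq> b \<otimes> a"
    "comm G b m \<in> center G" "comm G b m \<noteq> \<one>"
proof -
  interpret M: normal M G by (rule M)
  define C where "C = {c \<in> M. \<forall>m\<in>M. c \<otimes> m = m \<otimes> c}"
  have CM: "C \<subseteq> M" by (auto simp: C_def)
  have Ccomm: "c \<otimes> m = m \<otimes> c" if "c \<in> C" "m \<in> M" for c m using that by (auto simp: C_def)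
  have C_sub: "subgroup C G"
  proof (rule finite_closed_subset_subgroup[OF finite_carrier])
    show "C \<subseteq> carrier G" using CM M.subset by (rule subset_trans)
    have "\<one> \<in> C" by (simp add: C_def)
    then show "C \<noteq> {}" by blast
    fix x y assume xy: "x \<in> C" "y \<in> C"
    have "(x \<otimes> y) \<otimes> m = m \<otimes> (x \<otimes> y)" if m: "m \<in> M" for m
      using mult_commutes[OF M.mem_carrier M.mem_carrier M.mem_carrier, of x y m]
        subsetD[OF CM xy(1)] subsetD[OF CM xy(2)] m Ccomm[OF xy(1) m] Ccomm[OF xy(2) m]
      by (simp only:)
    moreover have "x \<otimes> y \<in> M" using xy CM by (intro M.m_closed) auto
    ultimately show "x \<otimes> y \<in> C" by (simp add: C_def)
  qed
  interpret C: subgroup C G by (rule C_sub)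
  have C_normal: "C \<lhd> G"
    unfolding normal_inv_iff
  proof (intro conjI ballI C_sub)
    fix g c assume g: "g \<in> carrier G" and c: "c \<in> C"
    have cG: "c \<in> carrier G" using c by (rule C.mem_carrier)
    have "(g \<otimes> c \<otimes> inv g) \<otimes> m = m \<otimes> (g \<otimes> c \<otimes> inv g)" if m: "m \<in> M" for m
    proof -
      (* m commutes with the conjugate of c because its own conjugate m' in M commutes with c *)
      define m' where "m' = inv g \<otimes> m \<otimes> g"
      have m': "m' \<in> M"
        using normal_conj_closed[OF M m, of "inv g"] g by (simp add: m'_def)
      have mG: "m \<in> carrier G" using m by (rule M.mem_carrier)
      have m'G: "m' \<in> carrier G" using m' by (rule M.mem_carrier)
      have m_eq: "m = g \<otimes> m' \<otimes> inv g"
        using g mG by (simp add: m'_def m_assoc mult_inv_cancel_left)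
      have "(g \<otimes> c \<otimes> inv g) \<otimes> m = g \<otimes> (c \<otimes> m') \<otimes> inv g"
        unfolding m_eq using g cG m'G by (simp add: m_assoc mult_inv_cancel_left)
      also have "c \<otimes> m' = m' \<otimes> c" by (rule Ccomm[OF c m'])
      also have "g \<otimes> (m' \<otimes> c) \<otimes> inv g = m \<otimes> (g \<otimes> c \<otimes> inv g)"
        unfolding m_eq using g cG m'G by (simp add: m_assoc mult_inv_cancel_left)
      finally show ?thesis .
    qed
    moreover have "g \<otimes> c \<otimes> inv g \<in> M" using normal_conj_closed[OF M subsetD[OF CM c] g] .
    ultimately show "g \<otimes> c \<otimes> inv g \<in> C" by (simp add: C_def)
  qed
  have "C \<subset> M" using CM nonab by (auto simp: C_def)
  then obtain b where b: "b \<in> M" "b \<notin> C" and bC: "\<And>g. g \<in> carrier G \<Longrightarrow> comm G b g \<in> C"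
    using exists_central_modulo[OF C_normal M] by blast
  have bG: "b \<in> carrier G" using b(1) by (rule M.mem_carrier)
  define I where "I = (\<lambda>m. comm G b m) ` M"
  have I_sub: "subgroup I G"
  proof (rule finite_closed_subset_subgroup[OF finite_carrier])
    show "I \<subseteq> carrier G"
      unfolding I_def by (rule image_subsetI) (intro comm_closed bG M.mem_carrier)
    show "I \<noteq> {}" unfolding I_def using b(1) by blast
    fix u v assume "u \<in> I" "v \<in> I"
    then obtain m k where mk: "m \<in> M" "k \<in> M" and uv: "u = comm G b m" "v = comm G b k"
      by (auto simp: I_def)
    have mkG: "m \<in> carrier G" "k \<in> carrier G" using mk by auto
    have "comm G b (m \<otimes> k) = u \<otimes> (m \<otimes> comm G b k \<otimes> inv m)"
      unfolding uv by (rule comm_mult_right[OF bG mkG])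
    also have "m \<otimes> comm G b k = comm G b k \<otimes> m"
      by (rule Ccomm[OF bC[OF mkG(2)] mk(1), symmetric])
    also have "comm G b k \<otimes> m \<otimes> inv m = v"
      unfolding uv using bG mkG by (simp add: m_assoc)
    finally show "u \<otimes> v \<in> I"
      unfolding I_def using mk by (intro image_eqI[where x = "m \<otimes> k"]) auto
  qed
  have I_normal: "I \<lhd> G"
    unfolding normal_inv_iff
  proof (intro conjI ballI I_sub)
    fix g u assume g: "g \<in> carrier G" and "u \<in> I"
    then obtain m where m: "m \<in> M" and u: "u = comm G b m" by (auto simp: I_def)
    define m' where "m' = g \<otimes> m \<otimes> inv g"
    have m': "m' \<in> M" unfolding m'_def by (rule normal_conj_closed[OF M m g])
    have m'G: "m' \<in> carrier G" and mG: "m \<in> carrier G" using m m' by auto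
    define c where "c = comm G g b"
    have c: "c \<in> C"
      using C.m_inv_closed[OF bC[OF g]] inv_comm[OF bG g] by (simp add: c_def)
    have cG: "c \<in> carrier G" using c by (rule C.mem_carrier)
    (* conjugation moves b by an element of the center of M only, which does not change [b, m'] *)
    have gb: "g \<otimes> b \<otimes> inv g = c \<otimes> b"
      using g bG by (simp add: c_def word_simps)
    have "g \<otimes> u \<otimes> inv g = comm G (c \<otimes> b) m'"
      unfolding u gb[symmetric] m'_def by (rule conj_comm[OF bG mG g])
    also have "\<dots> = c \<otimes> comm G b m' \<otimes> inv c \<otimes> comm G c m'"
      by (rule comm_mult_left[OF cG bG m'G])
    also have "comm G c m' = \<one>" using Ccomm[OF c m'] comm_eq_one_iff[OF cG m'G] by blast
    also have "c \<otimes> comm G b m' = comm G b m' \<otimes> c"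
      by (rule Ccomm[OF c subsetD[OF CM bC[OF m'G]]])
    also have "comm G b m' \<otimes> c \<otimes> inv c \<otimes> \<one> = comm G b m'"
      using bG cG m'G by (simp add: m_assoc)
    finally show "g \<otimes> u \<otimes> inv g \<in> I" using m' by (simp add: I_def)
  qed
  obtain a where a: "a \<in> M" "b \<otimes> a \<noteq> a \<otimes> b" using b by (auto simp: C_def)
  then have "comm G b a \<noteq> \<one>" using comm_eq_one_iff[OF bG] by auto
  then have "I \<noteq> {\<one>}" using a(1) by (auto simp: I_def)
  then obtain z where "z \<in> I" "z \<noteq> \<one>" "z \<in> center G"
    using normal_subgroup_meets_center[OF I_normal] normal_imp_subgroup[OF I_normal, THEN subgroup.mem_carrier]
    unfolding center_def by blast
  then obtain m where "m \<in> M" "comm G b m \<in> center G" "comm G b m \<noteq> \<one>"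
    by (auto simp: I_def)
  moreover have "\<exists>a\<in>M. a \<otimes> b \<noteq> b \<otimes> a" using a(1) a(2)[symmetric] by (rule bexI[rotated])
  ultimately show ?thesis using that b(1) by blast
qed

end

section \<open>Maximal class from an abelian maximal subgroup\<close>

context finite_p_group
begin

context
  fixes M g
  assumes M_normal: "M \<lhd> G" and M_index: "card M * p = p ^ n"
    and M_abelian: "\<And>a b. a \<in> M \<Longrightarrow> b \<in> M \<Longrightarrow> a \<otimes> b = b \<otimes> a"
    and g: "g \<in> carrier G" "g \<notin> M"
begin

interpretation M: normal M G by (rule M_normal)

text \<open>The induction principle of this section: a multiplicatively closed property that holds on the maximal
  subgroup \<open>M\<close> and at \<open>g\<close> holds on all of the group.\<close>
lemma mult_closed_over_maximal_eq_carrier: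
  assumes "H \<subseteq> carrier G" "M \<subseteq> H" "g \<in> H" "\<And>x y. x \<in> H \<Longrightarrow> y \<in> H \<Longrightarrow> x \<otimes> y \<in> H"
  shows "H = carrier G"
proof (rule subgroup_above_maximal[OF M_index])
  show "subgroup H G"
    using assms by (intro finite_closed_subset_subgroup finite_carrier) auto
qed (use assms g in auto)

lemma comm_image_hom:
  assumes "a \<in> M" "b \<in> M"
  shows "comm G (a \<otimes> b) g = comm G a g \<otimes> comm G b g"
proof -
  have c: "comm G a g \<in> M" "comm G b g \<in> M" using assms comm_in_normal[OF M_normal] g by auto
  have "comm G (a \<otimes> b) g = a \<otimes> comm G b g \<otimes> inv a \<otimes> comm G a g"
    using assms g by (intro comm_mult_left) auto
  also have "a \<otimes> comm G b g \<otimes> inv a = comm G b g"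
  proof -
    have "a \<otimes> comm G b g = comm G b g \<otimes> a" by (rule M_abelian[OF assms(1) c(2)])
    then have "a \<otimes> comm G b g \<otimes> inv a = comm G b g \<otimes> a \<otimes> inv a" by (rule arg_cong)
    then show ?thesis using assms c by (simp add: m_assoc)
  qed
  also have "comm G b g \<otimes> comm G a g = comm G a g \<otimes> comm G b g" by (rule M_abelian[OF c(2,1)])
  finally show ?thesis .
qed

context
  fixes N
  assumes N_normal: "N \<lhd> G" and N_sub: "N \<subseteq> M"
begin

interpretation N: normal N G by (rule N_normal)

lemma comm_image_subset: "(\<lambda>a. comm G a g) ` N \<subseteq> N"
  using comm_in_normal[OF N_normal] g by auto

lemma comm_image_subgroup: "subgroup ((\<lambda>a. comm G a g) ` N) G"
proof (rule finite_closed_subset_subgroup[OF finite_carrier])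
  show "(\<lambda>a. comm G a g) ` N \<subseteq> carrier G"
    using comm_image_subset N.subset by (rule subset_trans)
  show "(\<lambda>a. comm G a g) ` N \<noteq> {}" using N.one_closed by (simp only: image_is_empty) blast
  fix u v assume "u \<in> (\<lambda>a. comm G a g) ` N" "v \<in> (\<lambda>a. comm G a g) ` N"
  then obtain a b where ab: "a \<in> N" "b \<in> N" and uv: "u = comm G a g" "v = comm G b g" by auto
  have "u \<otimes> v = comm G (a \<otimes> b) g"
    unfolding uv by (rule comm_image_hom[OF subsetD[OF N_sub ab(1)] subsetD[OF N_sub ab(2)], symmetric])
  then show "u \<otimes> v \<in> (\<lambda>a. comm G a g) ` N" using N.m_closed[OF ab] by (rule image_eqI)
qed

text \<open>So commutators with \<open>g\<close> alone already give all commutators with elements of \<open>N\<close>. The elements \<open>h\<close>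
  with \<open>[a, h]\<close> in the image for all \<open>a \<in> N\<close> are closed under multiplication:
  \<open>[a, h k] = [a, h] (h u h\<^sup>-\<^sup>1)\<close> with \<open>u = [a, k] \<in> N\<close>, and \<open>h u h\<^sup>-\<^sup>1 = u [u\<^sup>-\<^sup>1, h]\<close>.\<close>
lemma comm_in_comm_image:
  assumes "a \<in> N" "h \<in> carrier G"
  shows "comm G a h \<in> (\<lambda>a. comm G a g) ` N"
proof -
  define D where "D = (\<lambda>a. comm G a g) ` N"
  interpret D: subgroup D G unfolding D_def by (rule comm_image_subgroup)
  have DN: "D \<subseteq> N" unfolding D_def by (rule comm_image_subset)
  have "{h \<in> carrier G. \<forall>a\<in>N. comm G a h \<in> D} = carrier G"
  proof (rule mult_closed_over_maximal_eq_carrier)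
    show "M \<subseteq> {h \<in> carrier G. \<forall>a\<in>N. comm G a h \<in> D}"
    proof (intro subsetI CollectI conjI ballI)
      fix h a assume h: "h \<in> M" "a \<in> N"
      then have "a \<otimes> h = h \<otimes> a" using N_sub M_abelian by auto
      then have "comm G a h = \<one>" using h by (simp add: comm_eq_one_iff)
      then show "comm G a h \<in> D" by simp
    qed auto
    show "g \<in> {h \<in> carrier G. \<forall>a\<in>N. comm G a h \<in> D}" using g by (auto simp: D_def)
    fix h k assume hk: "h \<in> {h \<in> carrier G. \<forall>a\<in>N. comm G a h \<in> D}"
      "k \<in> {h \<in> carrier G. \<forall>a\<in>N. comm G a h \<in> D}"
    have "comm G a (h \<otimes> k) \<in> D" if a: "a \<in> N" for a
    proof -
      define u where "u = comm G a k"
      have u: "u \<in> D" "u \<in> N" using hk a DN by (auto simp: u_def)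
      have "h \<otimes> u \<otimes> inv h = u \<otimes> comm G (inv u) h"
        using hk u by (intro conj_eq_comm_mult) auto
      also have "\<dots> \<in> D" using u hk by auto
      finally have "h \<otimes> u \<otimes> inv h \<in> D" .
      then show ?thesis using hk a u by (simp add: comm_mult_right u_def)
    qed
    then show "h \<otimes> k \<in> {h \<in> carrier G. \<forall>a\<in>N. comm G a h \<in> D}" using hk by auto
  qed auto
  then show ?thesis using assms unfolding D_def by blast
qed

lemma comm_image_normal: "(\<lambda>a. comm G a g) ` N \<lhd> G"
  unfolding normal_inv_iff
proof (intro conjI ballI comm_image_subgroup)
  interpret D: subgroup "(\<lambda>a. comm G a g) ` N" G by (rule comm_image_subgroup)
  fix h u assume h: "h \<in> carrier G" and u: "u \<in> (\<lambda>a. comm G a g) ` N"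
  have uN: "u \<in> N" using u comm_image_subset by auto
  have "h \<otimes> u \<otimes> inv h = u \<otimes> comm G (inv u) h"
    using h uN by (intro conj_eq_comm_mult) auto
  also have "\<dots> \<in> (\<lambda>a. comm G a g) ` N"
    by (intro D.m_closed u comm_in_comm_image h N.m_inv_closed uN)
  finally show "h \<otimes> u \<otimes> inv h \<in> (\<lambda>a. comm G a g) ` N" .
qed

lemma commutator_subgroup_eq_comm_image:
  "commutator_subgroup G N (carrier G) = (\<lambda>a. comm G a g) ` N"
proof
  show "commutator_subgroup G N (carrier G) \<subseteq> (\<lambda>a. comm G a g) ` N"
    unfolding commutator_subgroup_def
    by (rule generate_subgroup_incl[OF _ comm_image_subgroup])
      (use comm_in_comm_image in \<open>auto simp: comm_def\<close>)
  show "(\<lambda>a. comm G a g) ` N \<subseteq> commutator_subgroup G N (carrier G)"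
    unfolding commutator_subgroup_def comm_def using g by (auto intro!: generate.incl)
qed

text \<open>An element of \<open>M\<close> that commutes with \<open>g\<close> is central, as its centralizer contains \<open>M\<close> and \<open>g\<close>.\<close>
lemma card_comm_image:
  "card N = card ((\<lambda>a. comm G a g) ` N) * card (N \<inter> center G)"
proof (rule card_eq_card_image_mult_card_kernel[OF finite_carrier N.subgroup_axioms])
  fix a b assume ab: "a \<in> N" "b \<in> N"
  define c where "c = inv a \<otimes> b"
  have c: "c \<in> N" "b = a \<otimes> c" using ab by (auto simp: c_def mult_inv_cancel_left)
  have "comm G b g = comm G a g \<otimes> comm G c g"
    by (subst c(2), rule comm_image_hom) (use ab(1) c(1) N_sub in auto)
  then have "comm G a g = comm G b g \<longleftrightarrow> comm G c g = \<one>" using ab(1) c(1) g by simp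
  also have "\<dots> \<longleftrightarrow> c \<otimes> g = g \<otimes> c" using c(1) g by (auto simp: comm_eq_one_iff)
  also have "\<dots> \<longleftrightarrow> c \<in> center G"
  proof
    assume cg: "c \<otimes> g = g \<otimes> c"
    have "{h \<in> carrier G. h \<otimes> c = c \<otimes> h} = carrier G"
    proof (rule mult_closed_over_maximal_eq_carrier)
      show "M \<subseteq> {h \<in> carrier G. h \<otimes> c = c \<otimes> h}"
      proof (intro subsetI CollectI conjI)
        fix h assume h: "h \<in> M"
        then show "h \<in> carrier G" by (rule M.mem_carrier)
        show "h \<otimes> c = c \<otimes> h" by (rule M_abelian[OF h subsetD[OF N_sub c(1)]])
      qed
      show "g \<in> {h \<in> carrier G. h \<otimes> c = c \<otimes> h}" using g cg by simp
      fix x y assume "x \<in> {h \<in> carrier G. h \<otimes> c = c \<otimes> h}" "y \<in> {h \<in> carrier G. h \<otimes> c = c \<otimes> h}"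
      then show "x \<otimes> y \<in> {h \<in> carrier G. h \<otimes> c = c \<otimes> h}"
        by (intro CollectI conjI mult_commutes) (use c(1) in simp_all)
    qed auto
    then have "h \<otimes> c = c \<otimes> h" if "h \<in> carrier G" for h
    proof -
      have "h \<in> {h \<in> carrier G. h \<otimes> c = c \<otimes> h}"
        using that by (simp only: \<open>{h \<in> carrier G. h \<otimes> c = c \<otimes> h} = carrier G\<close>)
      then show ?thesis by simp
    qed
    then show "c \<in> center G" using N.mem_carrier[OF c(1)]
      unfolding center_def by (intro CollectI conjI ballI) auto
  qed (use g in \<open>simp add: center_def\<close>)
  finally show "comm G a g = comm G b g \<longleftrightarrow> inv a \<otimes> b \<in> N \<inter> center G"
    using c(1) by (auto simp: c_def)
qed auto

end

text \<open>The group is abelian modulo the image \<open>D\<close> of \<open>M\<close>. This takes two steps over the maximal subgroup, one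
  for each argument of the commutator, and each uses that \<open>D\<close> is normal.\<close>
lemma commutator_subgroup_carrier_eq_comm_image:
  "commutator_subgroup G (carrier G) (carrier G) = (\<lambda>a. comm G a g) ` M"
proof
  define D where "D = (\<lambda>a. comm G a g) ` M"
  have D_normal: "D \<lhd> G" unfolding D_def by (rule comm_image_normal[OF M_normal subset_refl])
  interpret D: normal D G by fact
  have MD: "comm G a h \<in> D" if "a \<in> M" "h \<in> carrier G" for a h
    unfolding D_def using comm_in_comm_image[OF M_normal subset_refl that] .
  have "{h \<in> carrier G. comm G h g \<in> D} = carrier G"
  proof (rule mult_closed_over_maximal_eq_carrier)
    fix h k assume "h \<in> {h \<in> carrier G. comm G h g \<in> D}" "k \<in> {h \<in> carrier G. comm G h g \<in> D}"
    then show "h \<otimes> k \<in> {h \<in> carrier G. comm G h g \<in> D}"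
      using g normal_conj_closed[OF D_normal] by (auto simp: comm_mult_left)
  qed (use g MD in auto)
  then have gD: "comm G h g \<in> D" if "h \<in> carrier G" for h using that by blast
  have "{k \<in> carrier G. \<forall>h\<in>carrier G. comm G h k \<in> D} = carrier G"
  proof (rule mult_closed_over_maximal_eq_carrier)
    show "M \<subseteq> {k \<in> carrier G. \<forall>h\<in>carrier G. comm G h k \<in> D}"
    proof (intro subsetI CollectI conjI ballI)
      fix k h assume k: "k \<in> M" "h \<in> carrier G"
      then have "comm G h k = inv (comm G k h)" by (simp add: inv_comm)
      then show "comm G h k \<in> D" using MD[OF k] by simp
    qed auto
    fix k l assume "k \<in> {k \<in> carrier G. \<forall>h\<in>carrier G. comm G h k \<in> D}"
      "l \<in> {k \<in> carrier G. \<forall>h\<in>carrier G. comm G h k \<in> D}"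
    then show "k \<otimes> l \<in> {k \<in> carrier G. \<forall>h\<in>carrier G. comm G h k \<in> D}"
      using normal_conj_closed[OF D_normal] by (auto simp: comm_mult_right)
  qed (use g gD in auto)
  then have all: "comm G h k \<in> D" if "h \<in> carrier G" "k \<in> carrier G" for h k using that by blast
  show "commutator_subgroup G (carrier G) (carrier G) \<subseteq> (\<lambda>a. comm G a g) ` M"
    unfolding commutator_subgroup_def D_def[symmetric]
    by (rule generate_subgroup_incl[OF _ D.subgroup_axioms]) (use all in \<open>auto simp: comm_def\<close>)
  show "(\<lambda>a. comm G a g) ` M \<subseteq> commutator_subgroup G (carrier G) (carrier G)"
    unfolding commutator_subgroup_def comm_def using g M.subset by (auto intro!: generate.incl)
qed

text \<open>A term of order \<open>> 1\<close> is normal and so meets the center. As the center has prime order, the term contains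
  it, and the map \<open>a \<mapsto> [a, g]\<close> divides its order by \<open>p\<close>. The case \<open>i = 0\<close> is the
  step from \<open>M\<close> to the derived subgroup.\<close>
lemma card_lower_central_series:
  assumes Z: "center G \<subseteq> M" "card (center G) = p" and i: "i + 2 \<le> n"
  shows "lower_central_series G (Suc i) \<lhd> G \<and> lower_central_series G (Suc i) \<subseteq> M \<and>
    card (lower_central_series G (Suc i)) = p ^ (n - 2 - i)"
  using i
proof (induction i)
  case 0
  have eq: "lower_central_series G (Suc 0) = (\<lambda>a. comm G a g) ` M"
    by (simp add: commutator_subgroup_carrier_eq_comm_image)
  have "card M = card ((\<lambda>a. comm G a g) ` M) * p"
    using card_comm_image[OF M_normal subset_refl] Z by (simp add: Int_absorb1)
  moreover have "p ^ n = p ^ (n - 2) * p * p"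
  proof -
    obtain m where "n = m + 2" using 0 le_Suc_ex[of 2 n] by auto
    then show ?thesis by (simp add: power_add power2_eq_square)
  qed
  ultimately have "card ((\<lambda>a. comm G a g) ` M) = p ^ (n - 2)"
    using M_index prime_gt_0_nat[OF prime_p] by simp
  then show ?case
    using comm_image_normal[OF M_normal subset_refl] comm_image_subset[OF M_normal subset_refl]
    unfolding eq by simp
next
  case (Suc i)
  define N where "N = lower_central_series G (Suc i)"
  have N: "N \<lhd> G" "N \<subseteq> M" "card N = p ^ (n - 2 - i)" using Suc by (auto simp: N_def)
  interpret N: normal N G by (rule N)
  have eq: "lower_central_series G (Suc (Suc i)) = (\<lambda>a. comm G a g) ` N"
    using commutator_subgroup_eq_comm_image[OF N(1,2)] by (simp add: N_def)
  have e: "n - 2 - i = Suc (n - 2 - Suc i)" using Suc.prems by simp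
  have "N \<noteq> {\<one>}"
  proof
    assume "N = {\<one>}"
    then have "p ^ Suc (n - 2 - Suc i) = 1" using N(3) e by simp
    then show False using prime_gt_1_nat[OF prime_p] by simp
  qed
  then have ne: "N \<inter> center G \<noteq> {\<one>}"
    using normal_subgroup_meets_center[OF N(1)] by (auto simp: center_def)
  have sub: "subgroup (N \<inter> center G) G"
    by (rule subgroups_Inter_pair[OF N.subgroup_axioms center_subgroup])
  have "p dvd card (N \<inter> center G)" by (rule prime_dvd_card_subgroup[OF sub ne])
  moreover have "card (N \<inter> center G) > 0"
    using finite_subgroup[OF sub] subgroup.one_closed[OF sub] by (subst card_gt_0_iff) blast
  moreover have "card (N \<inter> center G) \<le> p"
    using card_mono[OF finite_subgroup[OF center_subgroup], of "N \<inter> center G"] Z(2) by auto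
  ultimately have "card (N \<inter> center G) = p" using dvd_imp_le by fastforce
  then have "p ^ Suc (n - 2 - Suc i) = card ((\<lambda>a. comm G a g) ` N) * p"
    using card_comm_image[OF N(1,2)] N(3) e by simp
  then have "card ((\<lambda>a. comm G a g) ` N) = p ^ (n - 2 - Suc i)"
    using prime_gt_0_nat[OF prime_p] by simp
  then show ?case
    using comm_image_normal[OF N(1,2)] comm_image_subset[OF N(1,2)] N(2)
    unfolding eq by auto
qed

end

theorem maximal_class_if_abelian_maximal_subgroup:
  assumes M: "M \<lhd> G" "card M * p = p ^ n"
    "\<And>a b. a \<in> M \<Longrightarrow> b \<in> M \<Longrightarrow> a \<otimes> b = b \<otimes> a"
    and Z: "center G \<subseteq> M" "card (center G) = p"
  shows "p_group_of_maximal_class p G"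
proof -
  have p1: "p > 1" by (rule prime_gt_1_nat[OF prime_p])
  have Msub: "subgroup M G" using M(1) by (rule normal_imp_subgroup)
  have finM: "finite M" by (rule finite_subgroup[OF Msub])
  have "p \<le> card M" using card_mono[OF finM Z(1)] Z(2) by simp
  then have "p * p \<le> card M * p" by simp
  then have "p ^ 2 \<le> p ^ n" unfolding M(2) power2_eq_square .
  then have n2: "n \<ge> 2" using p1 by (simp add: power_increasing_iff)
  have "card M < card (carrier G)"
  proof -
    have "card M > 0" using \<open>p \<le> card M\<close> p1 by simp
    then have "card M < card M * p" using p1 by simp
    then show ?thesis using M(2) order_eq by (simp add: Coset.order_def)
  qed
  then have "M \<noteq> carrier G" by auto
  then obtain g where g: "g \<in> carrier G" "g \<notin> M" using subgroup.subset[OF Msub] by auto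
  note series = card_lower_central_series[OF M g Z]
  have last: "lower_central_series G (n - 1) = {\<one>}"
  proof -
    have e: "n - 1 = Suc (n - 2)" using n2 by simp
    have *: "lower_central_series G (n - 1) \<lhd> G" "card (lower_central_series G (n - 1)) = 1"
      unfolding e using series[of "n - 2"] n2 by auto
    then show ?thesis
      using subgroup.one_closed[OF normal_imp_subgroup[OF *(1)]] by (auto simp: card_1_singleton_iff)
  qed
  have nontriv: "n - 1 \<le> c" if c: "lower_central_series G c = {\<one>}" for c
  proof (rule ccontr)
    assume "\<not> n - 1 \<le> c"
    then have lt: "c < n - 1" by simp
    have "card (lower_central_series G c) > 1"
    proof (cases c)
      case 0
      have "1 < p ^ n" using p1 n2 by (intro one_less_power) auto
      then show ?thesis using 0 order_eq by (simp add: Coset.order_def)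
    next
      case (Suc i)
      have "1 < p ^ (n - 2 - i)" using p1 lt Suc by (intro one_less_power) auto
      then show ?thesis using series[of i] lt Suc by simp
    qed
    then show False using c by simp
  qed
  have "nilpotency_class G = n - 1"
    unfolding nilpotency_class_def by (rule Least_equality[where P = "\<lambda>c. lower_central_series G c = {\<one>}", OF last nontriv])
  then show ?thesis
    unfolding p_group_of_maximal_class_def nilpotent_group_def
    using prime_p is_group last n2 order_eq by blast
qed

end

section \<open>Irreducible representations, their scalars and their kernel\<close>

lemma mat_trace_comm:
  fixes A B :: "'a :: comm_semiring_0 mat"
  assumes A: "A \<in> carrier_mat n n" and B: "B \<in> carrier_mat n n"
  shows "mat_trace (A * B) = mat_trace (B * A)"
proof -
  have 1: "mat_trace (A * B) = (\<Sum>i<n. \<Sum>k<n. A $$ (i, k) * B $$ (k, i))"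
    using A B by (auto simp: mat_trace_def scalar_prod_def atLeast0LessThan intro!: sum.cong)
  have 2: "mat_trace (B * A) = (\<Sum>k<n. \<Sum>i<n. A $$ (i, k) * B $$ (k, i))"
    using A B by (auto simp: mat_trace_def scalar_prod_def atLeast0LessThan mult.commute intro!: sum.cong)
  show ?thesis unfolding 1 2 by (rule sum.swap)
qed

lemma mat_trace_smult:
  fixes A :: "'a :: semiring_0 mat"
  assumes "A \<in> carrier_mat n n"
  shows "mat_trace (c \<cdot>\<^sub>m A) = c * mat_trace A"
  using assms by (auto simp: mat_trace_def sum_distrib_left)

lemma subspace_module_vecI:
  fixes W :: "complex vec set"
  assumes "W \<subseteq> carrier_vec d" "0\<^sub>v d \<in> W"
    "\<And>u v. u \<in> W \<Longrightarrow> v \<in> W \<Longrightarrow> u + v \<in> W" "\<And>c v. v \<in> W \<Longrightarrow> c \<cdot>\<^sub>v v \<in> W"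
  shows "VectorSpace.subspace class_ring W (module_vec TYPE(complex) d)"
proof -
  interpret vec_space "TYPE(complex)" d .
  have "submodule class_ring W V"
    by (rule submodule.intro[OF module_axioms]) (use assms in \<open>auto simp: module_vec_def\<close>)
  then show ?thesis by (rule subspace.intro[OF vectorspace_axioms])
qed

lemma smult_one_mult:
  fixes A :: "'a :: comm_semiring_1 mat"
  assumes "A \<in> carrier_mat n m"
  shows "(c \<cdot>\<^sub>m 1\<^sub>m n) * A = c \<cdot>\<^sub>m A" "A * (c \<cdot>\<^sub>m 1\<^sub>m m) = c \<cdot>\<^sub>m A"
  using assms mult_smult_assoc_mat[of "1\<^sub>m n" n n A m c] mult_smult_distrib[of A n m "1\<^sub>m m" m c]
  by simp_all

locale irreducible_rep = group +
  fixes d :: nat and \<rho> :: "'a \<Rightarrow> complex mat"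
  assumes irreducible: "irreducible_representation G d \<rho>"
begin

lemma dim_pos: "d > 0"
  using irreducible by (simp add: irreducible_representation_def)

lemma rep_hom: "\<rho> \<in> hom G (GL d)"
  using irreducible by (simp add: irreducible_representation_def representation_def)

lemma rep_carrier [simp]:
  assumes "g \<in> carrier G" shows "\<rho> g \<in> carrier_mat d d"
proof -
  have "\<rho> g \<in> carrier (GL d)" using rep_hom assms by (auto simp: hom_def)
  then show ?thesis by (simp add: GL_def units_of_def Units_def ring_mat_def)
qed

lemma rep_mult: "g \<in> carrier G \<Longrightarrow> h \<in> carrier G \<Longrightarrow> \<rho> (g \<otimes> h) = \<rho> g * \<rho> h"
  using rep_hom by (simp add: hom_def GL_def units_of_def ring_mat_def)

lemma rep_one [simp]: "\<rho> \<one> = 1\<^sub>m d"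
proof -
  interpret R: ring "ring_mat TYPE(complex) d ()" by (rule ring_mat)
  interpret h: group_hom G "GL d" \<rho>
    by (intro group_hom.intro group_hom_axioms.intro rep_hom is_group)
      (simp add: GL_def R.units_group)
  have "\<one>\<^bsub>GL d\<^esub> = 1\<^sub>m d" by (simp add: GL_def units_of_def ring_mat_def)
  then show ?thesis using h.hom_one by simp
qed

text \<open>Irreducibility in the form in which it is used: a subspace is given by its closure properties.\<close>
lemma irreducibleD:
  assumes "W \<subseteq> carrier_vec d" "0\<^sub>v d \<in> W"
    "\<And>u v. u \<in> W \<Longrightarrow> v \<in> W \<Longrightarrow> u + v \<in> W" "\<And>c v. v \<in> W \<Longrightarrow> c \<cdot>\<^sub>v v \<in> W"
    "\<And>g v. g \<in> carrier G \<Longrightarrow> v \<in> W \<Longrightarrow> \<rho> g *\<^sub>v v \<in> W"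
    and v: "v \<in> W" "v \<noteq> 0\<^sub>v d"
  shows "W = carrier_vec d"
proof -
  have "invariant_subspace G d \<rho> W"
    unfolding invariant_subspace_def using subspace_module_vecI[OF assms(1-4)] assms(5) by auto
  then have "W = {0\<^sub>v d} \<or> W = carrier_vec d"
    using irreducible by (simp add: irreducible_representation_def)
  then show ?thesis using v by auto
qed

text \<open>An eigenspace of \<open>T\<close> is invariant and not zero, so it is everything.\<close>
lemma schur:
  assumes T: "T \<in> carrier_mat d d"
    and comm: "\<And>g. g \<in> carrier G \<Longrightarrow> T * \<rho> g = \<rho> g * T"
  shows "\<exists>c. T = c \<cdot>\<^sub>m 1\<^sub>m d"
proof -
  obtain c where "eigenvalue T c"
    using spectrum_non_empty[OF T dim_pos] by (auto simp: spectrum_def)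
  then obtain v where v: "v \<in> carrier_vec d" "v \<noteq> 0\<^sub>v d" "T *\<^sub>v v = c \<cdot>\<^sub>v v"
    using T by (auto simp: eigenvalue_def eigenvector_def)
  define W where "W = {v \<in> carrier_vec d. T *\<^sub>v v = c \<cdot>\<^sub>v v}"
  have W: "W = carrier_vec d"
  proof (rule irreducibleD)
    show "W \<subseteq> carrier_vec d" by (auto simp: W_def)
    show "0\<^sub>v d \<in> W" using T by (auto simp: W_def)
    show "v \<in> W" "v \<noteq> 0\<^sub>v d" using v by (auto simp: W_def)
    show "u + w \<in> W" if "u \<in> W" "w \<in> W" for u w
      using that T by (auto simp: W_def mult_add_distrib_mat_vec smult_add_distrib_vec)
    show "a \<cdot>\<^sub>v w \<in> W" if "w \<in> W" for a w
      using that T by (auto simp: W_def mult_mat_vec smult_smult_assoc mult.commute)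
    show "\<rho> g *\<^sub>v w \<in> W" if g: "g \<in> carrier G" and w: "w \<in> W" for g w
    proof -
      have wd: "w \<in> carrier_vec d" and Tw: "T *\<^sub>v w = c \<cdot>\<^sub>v w" using w by (auto simp: W_def)
      have "T *\<^sub>v (\<rho> g *\<^sub>v w) = (T * \<rho> g) *\<^sub>v w"
        by (rule assoc_mult_mat_vec[OF T rep_carrier[OF g] wd, symmetric])
      also have "\<dots> = \<rho> g *\<^sub>v (T *\<^sub>v w)"
        unfolding comm[OF g] by (rule assoc_mult_mat_vec[OF rep_carrier[OF g] T wd])
      also have "\<dots> = c \<cdot>\<^sub>v (\<rho> g *\<^sub>v w)"
        unfolding Tw by (rule mult_mat_vec[OF rep_carrier[OF g] wd])
      finally show ?thesis
        using mult_mat_vec_carrier[OF rep_carrier[OF g] wd] by (simp add: W_def)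
    qed
  qed
  have "T = c \<cdot>\<^sub>m 1\<^sub>m d"
  proof (rule eq_matI)
    fix i j assume "i < dim_row (c \<cdot>\<^sub>m 1\<^sub>m d)" "j < dim_col (c \<cdot>\<^sub>m 1\<^sub>m d)"
    then have ij: "i < d" "j < d" by auto
    have "unit_vec d j \<in> W" using W by simp
    then have "(T *\<^sub>v unit_vec d j) $ i = (c \<cdot>\<^sub>v unit_vec d j) $ i" by (simp add: W_def)
    then show "T $$ (i, j) = (c \<cdot>\<^sub>m 1\<^sub>m d) $$ (i, j)"
      using T ij by (auto simp: mult_mat_vec_def)
  qed (use T in auto)
  then show ?thesis ..
qed

text \<open>If all of the group acts by scalars, then already the line through the first unit vector is invariant.\<close>
lemma dim_eq_one_if_scalar:
  assumes "\<And>g. g \<in> carrier G \<Longrightarrow> \<exists>c. \<rho> g = c \<cdot>\<^sub>m 1\<^sub>m d"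
  shows "d = 1"
proof -
  define W where "W = range (\<lambda>c. c \<cdot>\<^sub>v unit_vec d 0 :: complex vec)"
  have "W = carrier_vec d"
  proof (rule irreducibleD)
    show "W \<subseteq> carrier_vec d" by (auto simp: W_def)
    have "0\<^sub>v d = (0 :: complex) \<cdot>\<^sub>v unit_vec d 0" by auto
    then show "0\<^sub>v d \<in> W" unfolding W_def by (rule range_eqI)
    have "unit_vec d 0 = (1 :: complex) \<cdot>\<^sub>v unit_vec d 0" by simp
    then show "unit_vec d 0 \<in> W" unfolding W_def by (rule range_eqI)
    show "unit_vec d 0 \<noteq> (0\<^sub>v d :: complex vec)" using dim_pos by simp
    show "u + w \<in> W" if uw: "u \<in> W" "w \<in> W" for u w
    proof -
      obtain a b where "u = a \<cdot>\<^sub>v unit_vec d 0" "w = b \<cdot>\<^sub>v unit_vec d 0" using uw by (auto simp: W_def)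
      then have "u + w = (a + b) \<cdot>\<^sub>v unit_vec d 0" by (simp add: add_smult_distrib_vec)
      then show ?thesis unfolding W_def by (rule range_eqI)
    qed
    show smult: "a \<cdot>\<^sub>v w \<in> W" if w: "w \<in> W" for a w
    proof -
      obtain b where "w = b \<cdot>\<^sub>v unit_vec d 0" using w by (auto simp: W_def)
      then have "a \<cdot>\<^sub>v w = (a * b) \<cdot>\<^sub>v unit_vec d 0" by (simp add: smult_smult_assoc)
      then show ?thesis unfolding W_def by (rule range_eqI)
    qed
    show "\<rho> g *\<^sub>v w \<in> W" if g: "g \<in> carrier G" and w: "w \<in> W" for g w
    proof -
      obtain c where c: "\<rho> g = c \<cdot>\<^sub>m 1\<^sub>m d" using assms[OF g] by blast
      have wd: "w \<in> carrier_vec d" using w by (auto simp: W_def)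
      have "\<rho> g *\<^sub>v w = c \<cdot>\<^sub>v w"
        unfolding c using wd by (auto simp: scalar_prod_left_unit intro!: eq_vecI)
      then show ?thesis using smult[OF w] by simp
    qed
  qed
  then have W1: "unit_vec d 1 \<in> W" by simp
  show ?thesis
  proof (rule ccontr)
    assume "d \<noteq> 1"
    then have d: "1 < d" using dim_pos by simp
    obtain a where a: "(unit_vec d 1 :: complex vec) = a \<cdot>\<^sub>v unit_vec d 0" using W1 by (auto simp: W_def)
    have "(unit_vec d 1 :: complex vec) $ 1 = (a \<cdot>\<^sub>v unit_vec d 0) $ 1" by (simp only: a)
    then show False using d by simp
  qed
qed

text \<open>\<open>rep_kernel\<close> and \<open>rep_center\<close> are the kernel and the center of the character that the representation
  affords. The diagonal entry in \<open>scalar\<close> is the factor by which an element of \<open>rep_center\<close> acts; on other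
  elements it has no meaning.\<close>
definition rep_kernel :: "'a set" where
  "rep_kernel = {g \<in> carrier G. \<rho> g = 1\<^sub>m d}"

definition rep_center :: "'a set" where
  "rep_center = {g \<in> carrier G. \<exists>c. \<rho> g = c \<cdot>\<^sub>m 1\<^sub>m d}"

definition scalar :: "'a \<Rightarrow> complex" where
  "scalar g = \<rho> g $$ (0, 0)"

lemma rep_center_closed: "z \<in> rep_center \<Longrightarrow> z \<in> carrier G"
  by (simp add: rep_center_def)

lemma rep_eq_scalar: "z \<in> rep_center \<Longrightarrow> \<rho> z = scalar z \<cdot>\<^sub>m 1\<^sub>m d"
  using dim_pos by (auto simp: rep_center_def scalar_def)

lemma scalar_unique: "\<rho> z = c \<cdot>\<^sub>m 1\<^sub>m d \<Longrightarrow> scalar z = c"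
  using dim_pos by (simp add: scalar_def)

lemma rep_kernel_iff: "z \<in> rep_kernel \<longleftrightarrow> z \<in> rep_center \<and> scalar z = 1"
proof
  assume z: "z \<in> rep_kernel"
  then have "\<rho> z = 1 \<cdot>\<^sub>m 1\<^sub>m d" by (auto simp: rep_kernel_def)
  then show "z \<in> rep_center \<and> scalar z = 1"
    using z scalar_unique[of z 1] unfolding rep_center_def rep_kernel_def by blast
next
  assume z: "z \<in> rep_center \<and> scalar z = 1"
  then have "\<rho> z = 1\<^sub>m d" using rep_eq_scalar[of z] by auto
  then show "z \<in> rep_kernel" using z by (simp add: rep_kernel_def rep_center_closed)
qed

lemma rep_kernel_subset_center: "rep_kernel \<subseteq> rep_center"
  using rep_kernel_iff by blast

lemma rep_center_mult:
  assumes z: "z \<in> rep_center" and w: "w \<in> rep_center"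
  shows "z \<otimes> w \<in> rep_center" "scalar (z \<otimes> w) = scalar z * scalar w"
proof -
  have zw: "z \<in> carrier G" "w \<in> carrier G" using z w by (auto simp: rep_center_closed)
  have "\<rho> (z \<otimes> w) = scalar z \<cdot>\<^sub>m \<rho> w"
    unfolding rep_mult[OF zw] rep_eq_scalar[OF z] by (rule smult_one_mult[OF rep_carrier[OF zw(2)]])
  also have "\<dots> = (scalar z * scalar w) \<cdot>\<^sub>m 1\<^sub>m d"
    by (subst rep_eq_scalar[OF w]) (auto intro!: eq_matI)
  finally have eq: "\<rho> (z \<otimes> w) = (scalar z * scalar w) \<cdot>\<^sub>m 1\<^sub>m d" .
  then show "z \<otimes> w \<in> rep_center" using zw unfolding rep_center_def by blast
  show "scalar (z \<otimes> w) = scalar z * scalar w" using eq by (rule scalar_unique)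
qed

lemma rep_center_conj:
  assumes z: "z \<in> rep_center" and g: "g \<in> carrier G"
  shows "g \<otimes> z \<otimes> inv g \<in> rep_center" "scalar (g \<otimes> z \<otimes> inv g) = scalar z"
proof -
  have zG: "z \<in> carrier G" using z by (rule rep_center_closed)
  have "\<rho> (g \<otimes> z \<otimes> inv g) = \<rho> g * (scalar z \<cdot>\<^sub>m 1\<^sub>m d) * \<rho> (inv g)"
    using g zG rep_eq_scalar[OF z] by (simp add: rep_mult)
  also have "\<dots> = scalar z \<cdot>\<^sub>m \<rho> g * \<rho> (inv g)"
    by (simp only: smult_one_mult(2)[OF rep_carrier[OF g]])
  also have "\<dots> = scalar z \<cdot>\<^sub>m (\<rho> g * \<rho> (inv g))"
    by (rule mult_smult_assoc_mat[OF rep_carrier[OF g] rep_carrier[OF inv_closed[OF g]]])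
  also have "\<rho> g * \<rho> (inv g) = 1\<^sub>m d"
    using g by (simp flip: rep_mult)
  finally have eq: "\<rho> (g \<otimes> z \<otimes> inv g) = scalar z \<cdot>\<^sub>m 1\<^sub>m d" .
  then show "g \<otimes> z \<otimes> inv g \<in> rep_center" using zG g unfolding rep_center_def by blast
  show "scalar (g \<otimes> z \<otimes> inv g) = scalar z" using eq by (rule scalar_unique)
qed

lemma one_in_rep_kernel: "\<one> \<in> rep_kernel"
  by (simp add: rep_kernel_def)

lemma rep_center_subgroup: "finite (carrier G) \<Longrightarrow> subgroup rep_center G"
  using one_in_rep_kernel rep_kernel_subset_center rep_center_mult(1)
  by (intro finite_closed_subset_subgroup) (auto simp: rep_center_closed)

lemma rep_kernel_subgroup: "finite (carrier G) \<Longrightarrow> subgroup rep_kernel G"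
  using one_in_rep_kernel
  by (intro finite_closed_subset_subgroup) (auto simp: rep_kernel_iff rep_center_mult rep_center_closed)

lemma rep_center_normal: "finite (carrier G) \<Longrightarrow> rep_center \<lhd> G"
  unfolding normal_inv_iff using rep_center_subgroup rep_center_conj(1) by blast

text \<open>This is the relation \<open>[x, g] g x = x g\<close> in the representation.\<close>
lemma comm_mem_rep_kernel_iff:
  assumes x: "x \<in> carrier G" and g: "g \<in> carrier G"
  shows "comm G x g \<in> rep_kernel \<longleftrightarrow> \<rho> x * \<rho> g = \<rho> g * \<rho> x"
proof
  have *: "comm G x g \<otimes> (g \<otimes> x) = x \<otimes> g"
    using x g by (simp add: word_simps)
  assume "comm G x g \<in> rep_kernel"
  then have 1: "\<rho> (comm G x g) = 1\<^sub>m d" by (simp add: rep_kernel_def)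
  have "\<rho> (x \<otimes> g) = 1\<^sub>m d * \<rho> (g \<otimes> x)"
    unfolding *[symmetric] 1[symmetric] using x g by (intro rep_mult) auto
  also have "\<dots> = \<rho> (g \<otimes> x)" using x g by (intro left_mult_one_mat[of _ d d] rep_carrier) auto
  finally show "\<rho> x * \<rho> g = \<rho> g * \<rho> x" using x g by (simp add: rep_mult)
next
  assume eq: "\<rho> x * \<rho> g = \<rho> g * \<rho> x"
  have **: "comm G x g = (x \<otimes> g) \<otimes> inv (g \<otimes> x)"
    using x g by (simp add: word_simps)
  have "\<rho> (comm G x g) = \<rho> (x \<otimes> g) * \<rho> (inv (g \<otimes> x))"
    unfolding ** using x g by (intro rep_mult) auto
  also have "\<rho> (x \<otimes> g) = \<rho> (g \<otimes> x)" using eq x g by (simp add: rep_mult)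
  also have "\<rho> (g \<otimes> x) * \<rho> (inv (g \<otimes> x)) = \<rho> ((g \<otimes> x) \<otimes> inv (g \<otimes> x))"
    using x g by (intro rep_mult[symmetric]) auto
  also have "\<dots> = 1\<^sub>m d" using x g by (simp del: m_assoc)
  finally show "comm G x g \<in> rep_kernel" using x g by (simp add: rep_kernel_def)
qed

text \<open>Modulo the kernel, the elements that act as scalars are the central ones; one direction is Schur's
  lemma.\<close>
lemma mem_rep_center_iff:
  assumes x: "x \<in> carrier G"
  shows "x \<in> rep_center \<longleftrightarrow> (\<forall>g\<in>carrier G. comm G x g \<in> rep_kernel)"
proof
  assume z: "x \<in> rep_center"
  show "\<forall>g\<in>carrier G. comm G x g \<in> rep_kernel"
  proof
    fix g assume g: "g \<in> carrier G"
    have "\<rho> x * \<rho> g = \<rho> g * \<rho> x"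
      unfolding rep_eq_scalar[OF z] by (simp only: smult_one_mult[OF rep_carrier[OF g]])
    then show "comm G x g \<in> rep_kernel" using comm_mem_rep_kernel_iff[OF x g] by blast
  qed
next
  assume all: "\<forall>g\<in>carrier G. comm G x g \<in> rep_kernel"
  have "\<exists>c. \<rho> x = c \<cdot>\<^sub>m 1\<^sub>m d"
    by (rule schur[OF rep_carrier[OF x]]) (use all comm_mem_rep_kernel_iff[OF x] in blast)
  then show "x \<in> rep_center" using x by (simp add: rep_center_def)
qed

text \<open>From \<open>g = [g, y] (y g y\<^sup>-\<^sup>1)\<close> the trace \<open>t\<close> of \<open>g\<close> satisfies \<open>t = c t\<close>, where
  \<open>c \<noteq> 1\<close> is the scalar of \<open>[g, y]\<close>.\<close>
lemma trace_eq_zero: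
  assumes g: "g \<in> carrier G" and y: "y \<in> carrier G"
    and c: "comm G g y \<in> rep_center" "comm G g y \<notin> rep_kernel"
  shows "mat_trace (\<rho> g) = 0"
proof -
  have yi: "inv y \<in> carrier G" using y by simp
  have yg: "y \<otimes> g \<in> carrier G" "y \<otimes> g \<otimes> inv y \<in> carrier G" using g y by auto
  have trace_conj: "mat_trace (\<rho> (y \<otimes> g \<otimes> inv y)) = mat_trace (\<rho> g)"
  proof -
    have "mat_trace (\<rho> (y \<otimes> g \<otimes> inv y)) = mat_trace (\<rho> (inv y) * \<rho> (y \<otimes> g))"
      unfolding rep_mult[OF yg(1) yi]
      by (rule mat_trace_comm[OF rep_carrier[OF yg(1)] rep_carrier[OF yi]])
    also have "\<rho> (inv y) * \<rho> (y \<otimes> g) = \<rho> g"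
      using g y by (simp add: mult_inv_cancel_left flip: rep_mult)
    finally show ?thesis .
  qed
  have "comm G g y \<otimes> (y \<otimes> g \<otimes> inv y) = g"
    using g y by (simp add: word_simps)
  then have "\<rho> g = \<rho> (comm G g y) * \<rho> (y \<otimes> g \<otimes> inv y)"
    using rep_mult[OF comm_closed[OF g y] yg(2)] by simp
  also have "\<dots> = scalar (comm G g y) \<cdot>\<^sub>m \<rho> (y \<otimes> g \<otimes> inv y)"
    unfolding rep_eq_scalar[OF c(1)] by (rule smult_one_mult[OF rep_carrier[OF yg(2)]])
  finally have "mat_trace (\<rho> g) = scalar (comm G g y) * mat_trace (\<rho> g)"
    using mat_trace_smult[OF rep_carrier[OF yg(2)]] trace_conj by metis
  moreover have "scalar (comm G g y) \<noteq> 1" using c rep_kernel_iff by blast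
  ultimately show ?thesis by simp
qed

end

section \<open>Zeros of a non-linear irreducible character of a p-group\<close>

locale p_group_irreducible_rep = finite_p_group + irreducible_rep +
  assumes dim_ne_one: "d \<noteq> 1"
begin

lemma rep_center_proper: "rep_center \<noteq> carrier G"
  using dim_eq_one_if_scalar dim_ne_one by (auto simp: rep_center_def set_eq_iff)

lemma exists_second_center_element:
  obtains x where "x \<in> carrier G" "x \<notin> rep_center" "x [^] p \<in> rep_center"
    "\<And>g. g \<in> carrier G \<Longrightarrow> comm G x g \<in> rep_center"
proof -
  have G: "carrier G \<lhd> G" by (simp add: normal_inv_iff subgroup_self)
  have "rep_center \<subset> carrier G" using rep_center_proper rep_center_closed by blast
  then show thesis
    using exists_central_modulo[OF rep_center_normal[OF finite_carrier] G] that by blast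
qed

context
  fixes x
  assumes x: "x \<in> carrier G" "x \<notin> rep_center" and xp: "x [^] p \<in> rep_center"
    and comm_x: "\<And>g. g \<in> carrier G \<Longrightarrow> comm G x g \<in> rep_center"
begin

text \<open>The conjugate of \<open>\<rho> g\<close> by \<open>\<rho> x\<close> is \<open>twist g\<close> times \<open>\<rho> g\<close>, that is, conjugation by
  \<open>x\<close> twists the representation by this linear character.\<close>
definition twist :: "'a \<Rightarrow> complex" where
  "twist g = scalar (comm G x g)"

lemma twist_mult:
  assumes "g \<in> carrier G" "h \<in> carrier G"
  shows "twist (g \<otimes> h) = twist g * twist h"
  using assms x(1) comm_x by (simp add: twist_def comm_mult_right rep_center_mult rep_center_conj)

lemma twist_eq_one_iff: "g \<in> carrier G \<Longrightarrow> twist g = 1 \<longleftrightarrow> comm G x g \<in> rep_kernel"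
  using comm_x by (simp add: twist_def rep_kernel_iff)

lemma comm_power:
  assumes g: "g \<in> carrier G"
  shows "comm G (x [^] k) g \<in> rep_center \<and> scalar (comm G (x [^] (k::nat)) g) = twist g ^ k"
proof (induction k)
  case 0
  have "comm G \<one> g = \<one>" using g by (simp add: comm_eq_one_iff)
  then show ?case using one_in_rep_kernel by (simp add: rep_kernel_iff)
next
  case (Suc k)
  have xk: "x [^] k \<in> carrier G" using x by simp
  have eq: "comm G (x [^] Suc k) g = (x [^] k \<otimes> comm G x g \<otimes> inv (x [^] k)) \<otimes> comm G (x [^] k) g"
    unfolding nat_pow_Suc by (rule comm_mult_left[OF xk x(1) g])
  show ?case
    unfolding eq using Suc rep_center_conj[OF comm_x[OF g] xk]
    by (simp add: rep_center_mult twist_def)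
qed

text \<open>As \<open>[x\<^sup>k, g]\<close> acts as \<open>twist g ^ k\<close>, the power \<open>twist g ^ p\<close> is the scalar of \<open>[x\<^sup>p, g]\<close>, which
  is 1 because \<open>x\<^sup>p\<close> acts as a scalar.\<close>
lemma twist_power:
  assumes g: "g \<in> carrier G" shows "twist g ^ p = 1"
proof -
  have "comm G (x [^] p) g \<in> rep_kernel"
    using xp mem_rep_center_iff g rep_center_closed by blast
  then show ?thesis using comm_power[OF g, of p] by (simp add: rep_kernel_iff)
qed

definition twist_kernel :: "'a set" where
  "twist_kernel = {g \<in> carrier G. comm G x g \<in> rep_kernel}"

lemma mem_twist_kernel_iff: "g \<in> twist_kernel \<longleftrightarrow> g \<in> carrier G \<and> twist g = 1"
  using twist_eq_one_iff by (auto simp: twist_kernel_def)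

lemma twist_kernel_subgroup: "subgroup twist_kernel G"
proof (rule finite_closed_subset_subgroup[OF finite_carrier])
  have "comm G x \<one> = \<one>" using x(1) by (simp add: comm_eq_one_iff)
  then have "\<one> \<in> twist_kernel" using one_in_rep_kernel by (simp add: twist_kernel_def)
  then show "twist_kernel \<noteq> {}" by blast
qed (auto simp: mem_twist_kernel_iff twist_mult)

lemma twist_kernel_normal: "twist_kernel \<lhd> G"
  unfolding normal_inv_iff
proof (intro conjI ballI twist_kernel_subgroup)
  fix g a assume g: "g \<in> carrier G" and a: "a \<in> twist_kernel"
  have aG: "a \<in> carrier G" and a1: "twist a = 1" using a by (auto simp: mem_twist_kernel_iff)
  have "twist (g \<otimes> a \<otimes> inv g) = twist g * twist (inv g)"
    using g aG a1 by (simp add: twist_mult)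
  also have "\<dots> = twist (g \<otimes> inv g)" using g by (intro twist_mult[symmetric]) auto
  also have "\<dots> = 1" using g subgroup.one_closed[OF twist_kernel_subgroup] by (simp add: mem_twist_kernel_iff)
  finally show "g \<otimes> a \<otimes> inv g \<in> twist_kernel" using g aG by (simp add: mem_twist_kernel_iff)
qed

lemma exists_twist_ne_one: "\<exists>g\<in>carrier G. twist g \<noteq> 1"
  using x mem_rep_center_iff[OF x(1)] twist_eq_one_iff by blast

text \<open>The image of \<open>twist\<close> has more than one element, at most \<open>p\<close> elements, and p-power order.\<close>
lemma twist_kernel_index: "card twist_kernel * p = p ^ n"
proof -
  have "card (carrier G) = card (twist ` carrier G) * card twist_kernel"
  proof (rule card_eq_card_image_mult_card_kernel[OF finite_carrier subgroup_self])
    show "twist_kernel \<subseteq> carrier G" by (auto simp: twist_kernel_def)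
    fix a b assume ab: "a \<in> carrier G" "b \<in> carrier G"
    define c where "c = inv a \<otimes> b"
    have c: "c \<in> carrier G" "a \<otimes> c = b" using ab by (auto simp: c_def mult_inv_cancel_left)
    have "twist b = twist a * twist c" using twist_mult[OF ab(1) c(1)] c(2) by simp
    moreover have "twist a \<noteq> 0"
      using twist_power[OF ab(1)] prime_gt_0_nat[OF prime_p] by (auto simp: power_0_left)
    ultimately have "twist a = twist b \<longleftrightarrow> twist c = 1" by auto
    then show "twist a = twist b \<longleftrightarrow> inv a \<otimes> b \<in> twist_kernel" using c(1) by (simp add: mem_twist_kernel_iff c_def)
  qed
  then have eq: "p ^ n = card (twist ` carrier G) * card twist_kernel"
    using order_eq by (simp add: Coset.order_def)
  have fin: "finite {z::complex. z ^ p = 1}"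
    using prime_gt_0_nat[OF prime_p] by (intro finite_roots_unity) simp
  have "card (twist ` carrier G) \<le> card {z::complex. z ^ p = 1}"
    using twist_power by (intro card_mono[OF fin]) auto
  also have "\<dots> = p" using prime_gt_0_nat[OF prime_p] by (rule card_roots_unity_eq)
  finally have le: "card (twist ` carrier G) \<le> p" .
  obtain i where i: "card (twist ` carrier G) = p ^ i"
    using dvd_prime_power[of "card (twist ` carrier G)" n] eq by (metis dvd_triv_left)
  have "i \<noteq> 0"
  proof
    assume "i = 0"
    then have "card (twist ` carrier G) = 1" using i by simp
    then obtain t where t: "twist ` carrier G = {t}" by (auto simp: card_1_singleton_iff)
    obtain g where g: "g \<in> carrier G" "twist g \<noteq> 1" using exists_twist_ne_one by blast
    have "twist g = twist \<one>" using t g(1) one_closed by (metis imageI singletonD)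
    moreover have "twist \<one> = 1" using subgroup.one_closed[OF twist_kernel_subgroup] by (simp add: mem_twist_kernel_iff)
    ultimately show False using g(2) by simp
  qed
  then have "p \<le> p ^ i" using prime_gt_1_nat[OF prime_p] by (simp add: self_le_power)
  then have "card (twist ` carrier G) = p" using le i by simp
  then show ?thesis using eq by (simp add: mult.commute)
qed

text \<open>The elements of \<open>rep_center\<close> itself are left out (\<open>i = 0\<close>), as their trace is not 0.\<close>
definition translates :: "'a set" where
  "translates = (\<lambda>(i, z). x [^] i \<otimes> z) ` ({1..<p} \<times> rep_center)"

lemma x_power_notin_rep_center:
  assumes "0 < i" "i < p" shows "x [^] (i::nat) \<notin> rep_center"
proof
  interpret Z: subgroup rep_center G by (rule rep_center_subgroup[OF finite_carrier])
  assume xi: "x [^] i \<in> rep_center"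
  obtain g where g: "g \<in> carrier G" "twist g \<noteq> 1" using exists_twist_ne_one by blast
  have "comm G (x [^] i) g \<in> rep_kernel" using xi mem_rep_center_iff g rep_center_closed by blast
  then have i1: "twist g ^ i = 1" using comm_power[OF g(1), of i] by (simp add: rep_kernel_iff)
  have "coprime i p"
    using assms prime_p by (metis coprime_commute nat_dvd_not_less prime_imp_coprime)
  (* the order of twist g divides both i and p, hence 1 *)
  then obtain a b where "a * i = b * p + 1"
    using coprime_bezout_strong[of i p] assms prime_gt_1_nat[OF prime_p] by (auto simp: mult.commute)
  then have "twist g ^ (a * i) = twist g ^ (b * p + 1)" by simp
  then have "twist g = 1"
    using i1 twist_power[OF g(1)] by (simp add: power_mult mult.commute[of _ i] mult.commute[of _ p])
  then show False using g(2) by simp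
qed

lemma twist_power_ne_one:
  assumes "0 < i" "i < p" obtains g where "g \<in> carrier G" "twist g ^ i \<noteq> 1"
proof -
  have "\<not> (\<forall>g\<in>carrier G. comm G (x [^] i) g \<in> rep_kernel)"
    using x_power_notin_rep_center[OF assms] mem_rep_center_iff[of "x [^] i"] x(1) by simp
  then obtain g where "g \<in> carrier G" "comm G (x [^] i) g \<notin> rep_kernel" by blast
  then show thesis using that comm_power[of g i] by (auto simp: rep_kernel_iff)
qed

lemma translates_elim:
  assumes "a \<in> translates"
  obtains i z where "0 < i" "i < p" "z \<in> rep_center" "a = x [^] i \<otimes> z"
proof -
  obtain i z where "(i, z) \<in> {1..<p} \<times> rep_center" "a = x [^] i \<otimes> z"
    using assms unfolding translates_def by (elim imageE) (simp split: prod.splits)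
  then show thesis using that[of i z] by simp
qed

lemma translates_subset_twist_kernel: "translates \<subseteq> twist_kernel"
proof
  fix a assume "a \<in> translates"
  then obtain i z where "0 < i" "i < p" and z: "z \<in> rep_center" and a: "a = x [^] i \<otimes> z"
    by (rule translates_elim)
  have zG: "z \<in> carrier G" using z by (rule rep_center_closed)
  have "x \<in> twist_kernel" using x(1) one_in_rep_kernel by (simp add: twist_kernel_def)
  then have "x [^] i \<in> twist_kernel"
    using twist_kernel_subgroup by (induction i) (auto intro: subgroup.one_closed subgroup.m_closed)
  moreover have "comm G z x \<in> rep_kernel" using z mem_rep_center_iff[OF zG] x(1) by blast
  then have "comm G x z \<in> rep_kernel"
    using inv_comm[OF zG x(1)] subgroup.m_inv_closed[OF rep_kernel_subgroup[OF finite_carrier]] by metis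
  then have "z \<in> twist_kernel" using zG by (simp add: twist_kernel_def)
  ultimately show "a \<in> twist_kernel" unfolding a by (rule subgroup.m_closed[OF twist_kernel_subgroup])
qed

text \<open>Modulo the kernel, \<open>[x\<^sup>i z, g] = [x, g]\<^sup>i\<close>, which acts as \<open>twist g ^ i\<close>; this is not 1
  for a suitable \<open>g\<close>.\<close>
lemma trace_zero_on_translates:
  assumes "a \<in> translates" shows "mat_trace (\<rho> a) = 0"
proof -
  obtain i z where i: "0 < i" "i < p" and z: "z \<in> rep_center" and a: "a = x [^] i \<otimes> z"
    using assms by (rule translates_elim)
  obtain g where g: "g \<in> carrier G" "twist g ^ i \<noteq> 1" using i by (rule twist_power_ne_one)
  have zG: "z \<in> carrier G" and xi: "x [^] i \<in> carrier G" using z x rep_center_closed by auto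
  have zg: "comm G z g \<in> rep_center" "scalar (comm G z g) = 1"
    using z mem_rep_center_iff[OF zG] g(1) by (auto simp: rep_kernel_iff)
  have eq: "comm G a g = (x [^] i \<otimes> comm G z g \<otimes> inv (x [^] i)) \<otimes> comm G (x [^] i) g"
    unfolding a by (rule comm_mult_left[OF xi zG g(1)])
  note conj = rep_center_conj[OF zg(1) xi]
  have "comm G a g \<in> rep_center" "scalar (comm G a g) = twist g ^ i"
    unfolding eq using conj comm_power[OF g(1), of i] zg by (simp_all add: rep_center_mult)
  then show ?thesis
    using g xi zG by (intro trace_eq_zero[of a g]) (auto simp: a rep_kernel_iff)
qed

lemma trace_zero_off_twist_kernel:
  assumes g: "g \<in> carrier G" "g \<notin> twist_kernel" shows "mat_trace (\<rho> g) = 0"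
proof -
  have K: "subgroup rep_kernel G" and Z: "subgroup rep_center G"
    using rep_kernel_subgroup rep_center_subgroup by auto
  have "comm G g x \<in> rep_center"
    using inv_comm[OF x(1) g(1)] subgroup.m_inv_closed[OF Z comm_x[OF g(1)]] by simp
  moreover have "comm G g x \<notin> rep_kernel"
    using inv_comm[OF g(1) x(1)] subgroup.m_inv_closed[OF K, of "comm G g x"] g by (auto simp: twist_kernel_def)
  ultimately show ?thesis using trace_eq_zero[OF g(1) x(1)] by blast
qed

lemma card_translates: "card translates = (p - 1) * card rep_center"
proof -
  interpret Z: subgroup rep_center G by (rule rep_center_subgroup[OF finite_carrier])
  have lt: False
    if "i < j" "j < p" and z: "z \<in> rep_center" "w \<in> rep_center"
      and eq: "x [^] i \<otimes> z = x [^] j \<otimes> w" for i j :: nat and z w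
  proof -
    have zw: "z \<in> carrier G" "w \<in> carrier G" using z by auto
    have "x [^] i \<otimes> z = x [^] i \<otimes> (x [^] (j - i) \<otimes> w)"
      using eq x(1) zw \<open>i < j\<close> by (simp add: nat_pow_mult flip: m_assoc)
    then have "z = x [^] (j - i) \<otimes> w" using x(1) zw by simp
    then have "x [^] (j - i) = z \<otimes> inv w" using x(1) zw by (simp add: inv_solve_right)
    then have "x [^] (j - i) \<in> rep_center" using z by simp
    then show False using x_power_notin_rep_center[of "j - i"] \<open>i < j\<close> \<open>j < p\<close> by simp
  qed
  have "inj_on (\<lambda>(i, z). x [^] i \<otimes> z) ({1..<p} \<times> rep_center)"
  proof (rule inj_onI, clarify)
    fix i j :: nat and z w
    assume ij: "i \<in> {1..<p}" "j \<in> {1..<p}" and zw: "z \<in> rep_center" "w \<in> rep_center"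
      and eq: "x [^] i \<otimes> z = x [^] j \<otimes> w"
    have "i = j" using lt[OF _ _ zw eq] lt[OF _ _ zw(2,1) eq[symmetric]] ij by fastforce
    moreover have "z = w" using eq zw x(1) \<open>i = j\<close> by simp
    ultimately show "i = j \<and> z = w" by blast
  qed
  then show ?thesis unfolding translates_def by (subst card_image) (auto simp: card_cartesian_product)
qed

lemma card_rep_center_ge: "p \<le> card rep_center"
proof -
  have Z: "subgroup rep_center G" by (rule rep_center_subgroup[OF finite_carrier])
  obtain g where g: "g \<in> carrier G" "twist g \<noteq> 1" using exists_twist_ne_one by blast
  then have "comm G x g \<notin> rep_kernel" using twist_eq_one_iff by blast
  then have "comm G x g \<noteq> \<one>" using one_in_rep_kernel by metis
  then have "rep_center \<noteq> {\<one>}" using comm_x[OF g(1)] by auto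
  then have "p dvd card rep_center" by (rule prime_dvd_card_subgroup[OF Z])
  moreover have "card rep_center > 0"
    using finite_subgroup[OF Z] subgroup.one_closed[OF Z] by (subst card_gt_0_iff) blast
  ultimately show ?thesis by (rule dvd_imp_le)
qed

lemma card_zeros:
  "card {g \<in> carrier G. mat_trace (\<rho> g) = 0} =
     p ^ n - p ^ (n - 1) + card {g \<in> twist_kernel. mat_trace (\<rho> g) = 0}"
proof -
  have sub: "twist_kernel \<subseteq> carrier G" by (auto simp: twist_kernel_def)
  have fin: "finite twist_kernel" using sub finite_carrier by (rule finite_subset)
  have "{g \<in> carrier G. mat_trace (\<rho> g) = 0} = (carrier G - twist_kernel) \<union> {g \<in> twist_kernel. mat_trace (\<rho> g) = 0}"
    using sub trace_zero_off_twist_kernel by auto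
  moreover have "card ((carrier G - twist_kernel) \<union> {g \<in> twist_kernel. mat_trace (\<rho> g) = 0}) =
      card (carrier G - twist_kernel) + card {g \<in> twist_kernel. mat_trace (\<rho> g) = 0}"
    using fin finite_carrier by (intro card_Un_disjoint) auto
  moreover have "card (carrier G - twist_kernel) = p ^ n - card twist_kernel"
    using card_Diff_subset[OF fin sub] order_eq by (simp add: Coset.order_def)
  moreover have "card twist_kernel = p ^ (n - 1)"
  proof -
    have "n \<noteq> 0"
    proof
      assume "n = 0"
      then have "p dvd 1" using twist_kernel_index by (metis dvd_triv_right power_0)
      then show False using prime_p by simp
    qed
    then have "p ^ n = p ^ (n - 1) * p" by (simp flip: power_Suc2)
    then show ?thesis using twist_kernel_index prime_gt_0_nat[OF prime_p] by simp
  qed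
  ultimately show ?thesis by simp
qed

lemma translates_subset_zeros: "translates \<subseteq> {g \<in> twist_kernel. mat_trace (\<rho> g) = 0}"
  using translates_subset_twist_kernel trace_zero_on_translates by blast

lemma finite_zeros_in_twist_kernel: "finite {g \<in> twist_kernel. mat_trace (\<rho> g) = 0}"
  using finite_subgroup[OF twist_kernel_subgroup] by simp

lemma card_zeros_in_twist_kernel_ge: "(p - 1) * card rep_center \<le> card {g \<in> twist_kernel. mat_trace (\<rho> g) = 0}"
  using card_mono[OF finite_zeros_in_twist_kernel translates_subset_zeros] card_translates by simp

lemma p_square_minus_p: "p ^ 2 - p = (p - 1) * p" "p \<le> p ^ 2"
  by (simp_all add: power2_eq_square diff_mult_distrib)

lemma card_zeros_ge:
  "p ^ n - p ^ (n - 1) + p ^ 2 - p \<le> card {g \<in> carrier G. mat_trace (\<rho> g) = 0}"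
proof -
  have "p ^ 2 - p \<le> (p - 1) * card rep_center"
    unfolding p_square_minus_p using card_rep_center_ge by (rule mult_le_mono2)
  then show ?thesis
    using card_zeros_in_twist_kernel_ge p_square_minus_p(2) unfolding card_zeros by linarith
qed

context
  assumes card_zeros_eq:
    "card {g \<in> carrier G. mat_trace (\<rho> g) = 0} = p ^ n - p ^ (n - 1) + p ^ 2 - p"
begin

lemma card_zeros_in_twist_kernel: "card {g \<in> twist_kernel. mat_trace (\<rho> g) = 0} = (p - 1) * p"
  using card_zeros_eq p_square_minus_p unfolding card_zeros by linarith

lemma card_rep_center: "card rep_center = p"
proof -
  have "(p - 1) * card rep_center \<le> (p - 1) * p"
    using card_zeros_in_twist_kernel_ge unfolding card_zeros_in_twist_kernel .
  then have "card rep_center \<le> p" using prime_gt_1_nat[OF prime_p] by simp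
  then show ?thesis using card_rep_center_ge by simp
qed

lemma zeros_in_twist_kernel: "{g \<in> twist_kernel. mat_trace (\<rho> g) = 0} = translates"
  using card_subset_eq[OF finite_zeros_in_twist_kernel translates_subset_zeros]
  by (simp add: card_translates card_rep_center card_zeros_in_twist_kernel)

text \<open>A non-trivial kernel would have at least \<open>p\<close> elements and so be all of \<open>rep_center\<close>, but some
  \<open>[x, g]\<close> acts as a scalar other than 1.\<close>
lemma rep_kernel_trivial: "rep_kernel = {\<one>}"
proof (rule ccontr)
  have K: "subgroup rep_kernel G" and Z: "subgroup rep_center G"
    using rep_kernel_subgroup rep_center_subgroup by auto
  assume "rep_kernel \<noteq> {\<one>}"
  then have "p dvd card rep_kernel" by (rule prime_dvd_card_subgroup[OF K])
  moreover have "card rep_kernel > 0"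
    using finite_subgroup[OF K] subgroup.one_closed[OF K] by (subst card_gt_0_iff) blast
  ultimately have "card rep_center \<le> card rep_kernel"
    unfolding card_rep_center by (rule dvd_imp_le)
  then have "rep_kernel = rep_center"
    using finite_subgroup[OF Z] rep_kernel_subset_center by (metis card_seteq)
  moreover obtain g where "g \<in> carrier G" "twist g \<noteq> 1" using exists_twist_ne_one by blast
  ultimately show False using comm_x twist_eq_one_iff by blast
qed

lemma rep_center_eq_center: "rep_center = center G"
proof -
  have "z \<in> rep_center \<longleftrightarrow> z \<in> center G" if z: "z \<in> carrier G" for z
    unfolding mem_rep_center_iff[OF z] rep_kernel_trivial center_def
    using z comm_eq_one_iff[OF z] by simp
  moreover have "center G \<subseteq> carrier G" by (auto simp: center_def)
  ultimately show ?thesis using rep_center_closed by blast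
qed

lemma mem_twist_kernel_iff_commutes: "g \<in> twist_kernel \<longleftrightarrow> g \<in> carrier G \<and> x \<otimes> g = g \<otimes> x"
  unfolding twist_kernel_def rep_kernel_trivial using comm_eq_one_iff[OF x(1)] by auto

lemma translates_commute:
  assumes "a \<in> translates" "m \<in> twist_kernel" shows "a \<otimes> m = m \<otimes> a"
proof -
  obtain i z where "0 < i" "i < p" and z: "z \<in> rep_center" and a: "a = x [^] i \<otimes> z"
    using assms(1) by (rule translates_elim)
  have m: "m \<in> carrier G" "x \<otimes> m = m \<otimes> x" using assms(2) by (simp_all add: mem_twist_kernel_iff_commutes)
  have "z \<otimes> m = m \<otimes> z" using z m(1) unfolding rep_center_eq_center center_def by blast
  then show ?thesis
    unfolding a using m z x(1)
    by (intro mult_commutes group_commutes_pow) (auto simp: rep_center_closed)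
qed

text \<open>Otherwise there is a zero \<open>b\<close> of the character that lies in \<open>twist_kernel\<close> but is not central there,
  whereas all zeros in \<open>twist_kernel\<close> are translates, and these are central there.\<close>
lemma twist_kernel_abelian:
  assumes "a \<in> twist_kernel" "b \<in> twist_kernel" shows "a \<otimes> b = b \<otimes> a"
proof (rule ccontr)
  assume "a \<otimes> b \<noteq> b \<otimes> a"
  then have nonab: "\<not> (\<forall>a\<in>twist_kernel. \<forall>b\<in>twist_kernel. a \<otimes> b = b \<otimes> a)" using assms by blast
  obtain b m where b: "b \<in> twist_kernel" and m: "m \<in> twist_kernel" and nc: "\<exists>a\<in>twist_kernel. a \<otimes> b \<noteq> b \<otimes> a"
    and c: "comm G b m \<in> center G" "comm G b m \<noteq> \<one>"
    by (rule nonabelian_normal_subgroup_central_commutator[OF twist_kernel_normal nonab])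
  have "mat_trace (\<rho> b) = 0"
    using b m c by (intro trace_eq_zero[of b m]) (auto simp: rep_center_eq_center rep_kernel_trivial mem_twist_kernel_iff)
  then have "b \<in> translates" using b zeros_in_twist_kernel by blast
  then show False using nc translates_commute by metis
qed

lemma maximal_class: "p_group_of_maximal_class p G"
proof (rule maximal_class_if_abelian_maximal_subgroup[OF twist_kernel_normal twist_kernel_index twist_kernel_abelian])
  show "center G \<subseteq> twist_kernel" using x(1) by (auto simp: mem_twist_kernel_iff_commutes center_def)
  show "card (center G) = p" using card_rep_center by (simp add: rep_center_eq_center)
qed

lemma twist_kernel_p_maximal: "p_maximal_subgroup p twist_kernel G"
proof -
  have "card (rcosets twist_kernel) * card twist_kernel = p * card twist_kernel"
    using lagrange_finite[OF finite_carrier twist_kernel_subgroup] twist_kernel_index order_eq by (simp add: mult.commute)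
  moreover have "card twist_kernel > 0"
    using finite_subgroup[OF twist_kernel_subgroup] subgroup.one_closed[OF twist_kernel_subgroup]
    by (subst card_gt_0_iff) blast
  ultimately show ?thesis using twist_kernel_subgroup by (simp add: p_maximal_subgroup_def)
qed

lemma twist_kernel_comm_group: "comm_group (G\<lparr>carrier := twist_kernel\<rparr>)"
proof (rule group.group_comm_groupI)
  show "group (G\<lparr>carrier := twist_kernel\<rparr>)" by (rule subgroup.subgroup_is_group[OF twist_kernel_subgroup is_group])
qed (use twist_kernel_abelian in simp)

end
end
end

theorem theoremB:
  fixes G :: "('a, 'b) monoid_scheme" and \<chi> :: "'a \<Rightarrow> complex" and p n :: nat
  assumes "prime p"
    and "group G"
    and "Coset.order G = p ^ n"
    and "irreducible_character G \<chi>"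
    and "\<not> linear_character G \<chi>"
  shows "card {g \<in> carrier G. \<chi> g = 0} \<ge> p ^ n - p ^ (n - 1) + p ^ 2 - p
    \<and> (card {g \<in> carrier G. \<chi> g = 0} = p ^ n - p ^ (n - 1) + p ^ 2 - p \<longrightarrow>
         p_group_of_maximal_class p G \<and>
         (\<exists>M. p_maximal_subgroup p M G \<and> comm_group (G\<lparr>carrier := M\<rparr>)))"
proof -
  obtain d \<rho> where irr: "irreducible_representation G d \<rho>"
    and \<chi>: "\<And>g. g \<in> carrier G \<Longrightarrow> \<chi> g = mat_trace (\<rho> g)"
    using assms(4) by (auto simp: irreducible_character_def)
  interpret group G by fact
  interpret R: irreducible_rep G d \<rho> by unfold_locales (rule irr)
  have "\<chi> \<one>\<^bsub>G\<^esub> = of_nat d" using \<chi>[of "\<one>\<^bsub>G\<^esub>"] by (simp add: mat_trace_def)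
  then have "d \<noteq> 1" using assms(5) by (auto simp: linear_character_def)
  interpret P: p_group_irreducible_rep G p n d \<rho>
    by unfold_locales (use assms(1,3) \<open>d \<noteq> 1\<close> in auto)
  obtain x where x: "x \<in> carrier G" "x \<notin> R.rep_center" "x [^]\<^bsub>G\<^esub> p \<in> R.rep_center"
    "\<And>g. g \<in> carrier G \<Longrightarrow> comm G x g \<in> R.rep_center"
    using P.exists_second_center_element by blast
  have zeros: "{g \<in> carrier G. \<chi> g = 0} = {g \<in> carrier G. mat_trace (\<rho> g) = 0}"
    using \<chi> by auto
  show ?thesis
    unfolding zeros
    using P.card_zeros_ge[OF x] P.maximal_class[OF x]
      P.twist_kernel_p_maximal[OF x] P.twist_kernel_comm_group[OF x] by blast
qed

end
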